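(* Consider the extended system $\dot z=F(z)$, $z=(x,y)\in\mathbb{R}^{n+d}$, $$\dot x=\tilde f(x,y),\qquad \dot y=-M^\dagger(x,y)\,N(x,y)\,\tilde f(x,y),$$ of a system $\dot x=f(x)$ on $\mathbb{R}^n$ with invariant $H$, as described in the context, and apply to it the implicit midpoint method $z_{n+1}=z_n+h\,F\bigl(\tfrac{z_n+z_{n+1}}2\bigr)$. Then: (1) The method is a second-order discretization that exactly preserves the quadratic invariants of the extended system. (2) In particular, if the initial data satisfy the constraint $G(x_0,y_0)=0$, then the numerical solution remains on the constraint manifold, $G(x_n,y_n)=0$, for all time steps $n$. (3) After eliminating the auxiliary variables through the constraint relation $y_n=\varphi(x_n)$, the resulting reduced method $$\frac{x_{n+1}-x_n}{h}=\tilde f\Bigl(\frac{x_n+x_{n+1}}2,\frac{\varphi(x_n)+\varphi(x_{n+1})}2\Bigr)$$ is a second-order integrator that exactly preserves the original invariant inherited from the continuous system: $H(x_{n+1})=H(x_n)$ for all $n$.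
   Context: $H:\mathbb{R}^n\to\mathbb{R}$ is an invariant of $\dot x=f(x)$, i.e. $\nabla H(x)^\top f(x)=0$. $G=(G_1,\dots,G_d):\mathbb{R}^{n+d}\to\mathbb{R}^d$ is a quadratic dimension-raising transformation for $H$. Here a dimension-raising transformation is a continuously differentiable $G$ with $\partial_yG(x,y)\in\mathbb{R}^{d\times d}$ nonsingular such that $H$ is embedded in a function $\widetilde H:\mathbb{R}^{n+d}\to\mathbb{R}$ with $\widetilde H(x,y)|_{G(x,y)=0}=H(x)$; in the quadratic case $\widetilde H$ is a quadratic function. Each $G_i$ is a homogeneous quadratic polynomial: with $z=(x^\top,y^\top)^\top$, $G_i(x,y)=\frac12 z^\top Q^iz$, where $Q^i\in\mathbb{R}^{(n+d)\times(n+d)}$ is symmetric and partitioned as $Q^i=\begin{pmatrix}Q^i_{11}&Q^i_{12}\\(Q^i_{12})^\top&Q^i_{22}\end{pmatrix}$. The Jacobian is $DG=(N\mid M)$, where the $i$-th row of $N(x,y)\in\mathbb{R}^{d\times n}$ is $x^\top Q^i_{11}+y^\top(Q^i_{12})^\top$ and the $i$-th row of $M(x,y)\in\mathbb{R}^{d\times d}$ is $x^\top Q^i_{12}+y^\top Q^i_{22}$. $M^\dagger$ is the Moore--Penrose pseudoinverse of $M$; if $M$ has full column rank, then $M^\dagger=(M^\top M)^{-1}M^\top$. The constraint manifold $\{G=0\}$ is assumed to be represented as a graph $y=\varphi(x)$ of a smooth map $\varphi:\mathbb{R}^n\to\mathbb{R}^d$, and $\tilde f:\mathbb{R}^{n+d}\to\mathbb{R}^n$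 is consistent with the original system there: $\tilde f(x,\varphi(x))=f(x)$. A quadratic invariant of the extended system is a quadratic function of $z$ that is constant along every trajectory of the system. $h$ is the time step, $z_n=(x_n,y_n)$ the numerical solution, and "second order" refers to the order of accuracy in $h$.
   Formalization: Stated on open regions of z- and x-space, since ∂_yG is singular at 0; f̃ is assumed C² for second order; H(x_{n+1})=H(x_n) is proved when H̃ is a quadratic invariant of the extended system, as consistency of f̃ on {G=0} alone does not suffice. *)

theory Defs
  imports "HOL-Analysis.Analysis"
begin

text \<open>
  \<open>C\<^sup>k\<close> regularity on an open set of a Euclidean space, expressed through iterated directional
  derivatives so that the codomain does not change along the recursion.
\<close>

primrec Ck_on :: "nat \<Rightarrow> 'a::euclidean_space set \<Rightarrow> ('a \<Rightarrow> 'b::real_normed_vector) \<Rightarrow> bool" where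
  "Ck_on 0 S f \<longleftrightarrow> continuous_on S f"
| "Ck_on (Suc k) S f \<longleftrightarrow> (\<forall>x\<in>S. f differentiable (at x)) \<and>
     (\<forall>v. Ck_on k S (\<lambda>x. frechet_derivative f (at x) v))"

definition smooth_on :: "'a::euclidean_space set \<Rightarrow> ('a \<Rightarrow> 'b::real_normed_vector) \<Rightarrow> bool" where
  "smooth_on S f \<longleftrightarrow> (\<forall>k. Ck_on k S f)"

text \<open>A polynomial of degree at most two; affine terms are allowed.\<close>

definition quadratic_function :: "('a::euclidean_space \<Rightarrow> real) \<Rightarrow> bool" where
  "quadratic_function q \<longleftrightarrow>
     (\<exists>B l c. bilinear B \<and> linear l \<and> q = (\<lambda>z. B z z + l z + c))"


section \<open>Trajectories and invariants\<close>

definition trajectory ::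
  "('a::real_normed_vector \<Rightarrow> 'a) \<Rightarrow> 'a set \<Rightarrow> real set \<Rightarrow> (real \<Rightarrow> 'a) \<Rightarrow> bool" where
  "trajectory F S I w \<longleftrightarrow> is_interval I \<and>
     (\<forall>t\<in>I. w t \<in> S \<and> (w has_vector_derivative F (w t)) (at t within I))"

definition gradient_invariant ::
  "('a::real_inner \<Rightarrow> 'a) \<Rightarrow> 'a set \<Rightarrow> ('a \<Rightarrow> real) \<Rightarrow> bool" where
  "gradient_invariant f S H \<longleftrightarrow> (\<forall>x\<in>S. \<exists>g. GDERIV H x :> g \<and> g \<bullet> f x = 0)"

definition quadratic_invariant ::
  "('a::euclidean_space \<Rightarrow> 'a) \<Rightarrow> 'a set \<Rightarrow> ('a \<Rightarrow> real) \<Rightarrow> bool" where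
  "quadratic_invariant F S q \<longleftrightarrow> quadratic_function q \<and>
     (\<forall>I w. trajectory F S I w \<longrightarrow> (\<lambda>t. q (w t)) constant_on I)"


section \<open>One-step methods and their order\<close>

text \<open>
  A possibly implicit one-step method is a relation: \<open>\<Phi> h u v\<close> says that \<open>v\<close> is an admissible
  result of a step of size \<open>h\<close> from \<open>u\<close>.
\<close>

definition numerical_solution ::
  "(real \<Rightarrow> 'a \<Rightarrow> 'a \<Rightarrow> bool) \<Rightarrow> real \<Rightarrow> nat \<Rightarrow> (nat \<Rightarrow> 'a) \<Rightarrow> bool" where
  "numerical_solution \<Phi> h K u \<longleftrightarrow> (\<forall>k<K. \<Phi> h (u k) (u (Suc k)))"

text \<open>
  The equation defining an implicit step may have spurious solutions far away from the current
  point, even for arbitrarily small step sizes. Order statements therefore concern the solution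
  within some fixed distance \<open>\<delta>\<close>, which is required to exist and to be unique.
  The constants in the local error bound are uniform for initial values in a compact set.
\<close>

definition local_error_order ::
  "('a::euclidean_space \<Rightarrow> 'a) \<Rightarrow> 'a set \<Rightarrow> (real \<Rightarrow> 'a \<Rightarrow> 'a \<Rightarrow> bool) \<Rightarrow> nat \<Rightarrow> bool" where
  "local_error_order F S \<Phi> p \<longleftrightarrow>
     (\<forall>K. compact K \<and> K \<subseteq> S \<longrightarrow>
       (\<exists>h0>0. \<exists>\<delta>>0. \<exists>C. \<forall>h u. 0 < h \<and> h \<le> h0 \<and> u \<in> K \<longrightarrow>
          (\<exists>!v. v \<in> ball u \<delta> \<and> \<Phi> h u v) \<and>
          (\<forall>v w. v \<in> ball u \<delta> \<and> \<Phi> h u v \<and> trajectory F S {0..h} w \<and> w 0 = u \<longrightarrow>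
             norm (v - w h) \<le> C * h ^ (p + 1))))"

definition global_error_order ::
  "('a::euclidean_space \<Rightarrow> 'a) \<Rightarrow> 'a set \<Rightarrow> (real \<Rightarrow> 'a \<Rightarrow> 'a \<Rightarrow> bool) \<Rightarrow> nat \<Rightarrow> bool" where
  "global_error_order F S \<Phi> p \<longleftrightarrow>
     (\<forall>T w. trajectory F S {0..T} w \<longrightarrow>
       (\<exists>h0>0. \<exists>\<delta>>0. \<exists>C. \<forall>h K. 0 < h \<and> h \<le> h0 \<and> real K * h \<le> T \<longrightarrow>
          (\<exists>u. u 0 = w 0 \<and> numerical_solution \<Phi> h K u \<and>
             (\<forall>k<K. u (Suc k) \<in> ball (u k) \<delta>)) \<and>
          (\<forall>u. u 0 = w 0 \<and> numerical_solution \<Phi> h K u \<and>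
             (\<forall>k<K. u (Suc k) \<in> ball (u k) \<delta>) \<longrightarrow>
             (\<forall>k\<le>K. norm (u k - w (real k * h)) \<le> C * h ^ p))))"

definition has_order ::
  "('a::euclidean_space \<Rightarrow> 'a) \<Rightarrow> 'a set \<Rightarrow> (real \<Rightarrow> 'a \<Rightarrow> 'a \<Rightarrow> bool) \<Rightarrow> nat \<Rightarrow> bool" where
  "has_order F S \<Phi> p \<longleftrightarrow> local_error_order F S \<Phi> p \<and> global_error_order F S \<Phi> p"

text \<open>The vector field is only meaningful on \<open>S\<close>, so the stage value has to lie in \<open>S\<close>.\<close>

definition implicit_midpoint ::
  "('a::real_normed_vector \<Rightarrow> 'a) \<Rightarrow> 'a set \<Rightarrow> real \<Rightarrow> 'a \<Rightarrow> 'a \<Rightarrow> bool" where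
  "implicit_midpoint F S h u v \<longleftrightarrow> midpoint u v \<in> S \<and> v = u + h *\<^sub>R F (midpoint u v)"


section \<open>Quadratic dimension-raising transformations\<close>

text \<open>
  Everything is relative to a region \<open>\<Omega>\<close> of the extended space: for a homogeneous quadratic \<open>G\<close> the
  partial derivative with respect to \<open>y\<close> vanishes at the origin, so \<open>\<Omega>\<close> cannot be the whole space.
\<close>

definition dimension_raising ::
  "((real^'n) \<times> (real^'d)) set \<Rightarrow> ((real^'n) \<times> (real^'d) \<Rightarrow> real^'d) \<Rightarrow>
   (real^'n \<Rightarrow> real) \<Rightarrow> ((real^'n) \<times> (real^'d) \<Rightarrow> real) \<Rightarrow> bool" where
  "dimension_raising \<Omega> G H Ht \<longleftrightarrow>
     Ck_on 1 \<Omega> G \<and>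
     (\<forall>(x, y)\<in>\<Omega>. invertible (matrix (frechet_derivative (\<lambda>v. G (x, v)) (at y)))) \<and>
     (\<forall>(x, y)\<in>\<Omega>. G (x, y) = 0 \<longrightarrow> Ht (x, y) = H x)"

definition quadratic_dimension_raising ::
  "((real^'n) \<times> (real^'d)) set \<Rightarrow> ((real^'n) \<times> (real^'d) \<Rightarrow> real^'d) \<Rightarrow>
   (real^'n \<Rightarrow> real) \<Rightarrow> ((real^'n) \<times> (real^'d) \<Rightarrow> real) \<Rightarrow> bool" where
  "quadratic_dimension_raising \<Omega> G H Ht \<longleftrightarrow>
     dimension_raising \<Omega> G H Ht \<and> quadratic_function Ht"

text \<open>
  Vectors of dimension \<open>n + d\<close> and the blocks of a matrix of that size are indexed by the
  disjoint sum of the two index types.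
\<close>

definition stack :: "(real^'n::finite) \<times> (real^'d::finite) \<Rightarrow> real^('n + 'd)" where
  "stack z = (\<chi> k. case k of Inl i \<Rightarrow> fst z $ i | Inr j \<Rightarrow> snd z $ j)"

definition block11 :: "real^('n::finite + 'd::finite)^('n + 'd) \<Rightarrow> real^'n^'n" where
  "block11 A = (\<chi> i j. A $ Inl i $ Inl j)"

definition block12 :: "real^('n::finite + 'd::finite)^('n + 'd) \<Rightarrow> real^'d^'n" where
  "block12 A = (\<chi> i j. A $ Inl i $ Inr j)"

definition block22 :: "real^('n::finite + 'd::finite)^('n + 'd) \<Rightarrow> real^'d^'d" where
  "block22 A = (\<chi> i j. A $ Inr i $ Inr j)"

definition quadratic_forms ::
  "('d \<Rightarrow> real^('n::finite + 'd)^('n + 'd)) \<Rightarrow> (real^'n) \<times> (real^'d::finite) \<Rightarrow> real^'d" where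
  "quadratic_forms Q z = (\<chi> i. 1 / 2 * (stack z \<bullet> (Q i *v stack z)))"

definition jacobian_x ::
  "('d \<Rightarrow> real^('n::finite + 'd)^('n + 'd)) \<Rightarrow> (real^'n) \<times> (real^'d::finite) \<Rightarrow> real^'n^'d" where
  "jacobian_x Q = (\<lambda>(x, y). \<chi> i. x v* block11 (Q i) + y v* transpose (block12 (Q i)))"

definition jacobian_y ::
  "('d \<Rightarrow> real^('n::finite + 'd)^('n + 'd)) \<Rightarrow> (real^'n) \<times> (real^'d::finite) \<Rightarrow> real^'d^'d" where
  "jacobian_y Q = (\<lambda>(x, y). \<chi> i. x v* block12 (Q i) + y v* block22 (Q i))"

text \<open>The Moore--Penrose pseudoinverse, given by the four Penrose equations.\<close>

definition pseudoinverse :: "real^'n^'m \<Rightarrow> real^'m^'n" where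
  "pseudoinverse A = (THE X. A ** X ** A = A \<and> X ** A ** X = X \<and>
     transpose (A ** X) = A ** X \<and> transpose (X ** A) = X ** A)"

definition extended_field ::
  "('d \<Rightarrow> real^('n::finite + 'd)^('n + 'd)) \<Rightarrow> ((real^'n) \<times> (real^'d) \<Rightarrow> real^'n) \<Rightarrow>
   (real^'n) \<times> (real^'d::finite) \<Rightarrow> (real^'n) \<times> (real^'d)" where
  "extended_field Q ft z =
     (ft z, - ((pseudoinverse (jacobian_y Q z) ** jacobian_x Q z) *v ft z))"

definition reduced_midpoint ::
  "((real^'n) \<times> (real^'d) \<Rightarrow> real^'n) \<Rightarrow> (real^'n \<Rightarrow> real^'d) \<Rightarrow>
   ((real^'n) \<times> (real^'d)) set \<Rightarrow> (real^'n) set \<Rightarrow> real \<Rightarrow> real^'n \<Rightarrow> real^'n \<Rightarrow> bool" where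
  "reduced_midpoint ft \<phi> \<Omega> D h x x' \<longleftrightarrow>
     x \<in> D \<and> x' \<in> D \<and> (midpoint x x', midpoint (\<phi> x) (\<phi> x')) \<in> \<Omega> \<and>
     (x' - x) /\<^sub>R h = ft (midpoint x x', midpoint (\<phi> x) (\<phi> x'))"

end

theory Submission
  imports Defs
begin

text \<open>
  The Jacobian of a quadratic map at a midpoint maps \<open>v - u\<close> to the exact difference of its values.
  Hence one midpoint step changes a quadratic invariant \<open>q\<close> by \<open>h\<close> times the derivative of \<open>q\<close> along
  \<open>F\<close> at the midpoint, which vanishes because a trajectory starts there (Picard iteration). The
  constraint \<open>G\<close> is preserved for the same reason: \<open>N ft - M M\<^sup>\<dagger> N ft = 0\<close>.

  Order two of both methods comes from one convergence argument for steps \<open>v = u + h \<Psi> u v\<close> with a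
  locally Lipschitz \<open>\<Psi>\<close> and a defect of size \<open>h\<^sup>3\<close> along trajectories. On the graph \<open>y = \<phi> x\<close> the
  reduced and the extended method, as well as the reduced and the extended trajectories, coincide, so
  the reduced method inherits the defect bound of the implicit midpoint method.
\<close>

section \<open>Calculus of \<open>C\<^sup>k\<close> functions\<close>

text \<open>The obstacle is that the midpoint of two points of the constraint manifold generally
  lies off it. Facts on the graph alone therefore do not control a step: \<open>ft\<close> is
  evaluated where consistency does not tie it to \<open>f\<close>, and \<open>Ht\<close> is
  differentiated where it is not tied to \<open>H\<close>. For \<open>G\<close> this does no harm,
  because its derivative along \<open>F\<close> vanishes throughout \<open>\<Omega>\<close>. For
  \<open>H\<close> the property that counts is invariance of \<open>Ht\<close> for \<open>F\<close>
  on all of \<open>\<Omega>\<close>, which is the premise of the last clause of the theorem. As to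
  the order, the reduced method is in general not the midpoint method of \<open>f\<close>; its
  defect is read off the extended method, where the stage is an ordinary point of
  \<open>\<Omega>\<close>. Two derivatives of \<open>F\<close> suffice for a defect of size
  \<open>h ^ 3\<close>: the estimates use Lipschitz constants of \<open>F\<close> and of its
  derivative along itself, never a third derivative of a trajectory. Solutions of a step are
  compared only inside a ball of fixed radius, so the global estimate has to confirm at every step
  that the numerical solution stays in the range of the local bounds.\<close>

lemma Ck_on_cong:
  assumes "open S" and "\<And>x. x \<in> S \<Longrightarrow> f x = g x" and "Ck_on k S f"
  shows "Ck_on k S g"
  using assms(2,3)
proof (induction k arbitrary: f g)
  case 0
  then show ?case
    using continuous_on_cong[of S S f g] by simp
next
  case (Suc k)
  have d: "(g has_derivative frechet_derivative f (at x)) (at x)" if "x \<in> S" for x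
    using Suc.prems that \<open>open S\<close>
    by (intro has_derivative_transform_within_open[of f _ x UNIV S g])
       (auto simp: frechet_derivative_works)
  then have e: "frechet_derivative g (at x) = frechet_derivative f (at x)" if "x \<in> S" for x
    using frechet_derivative_at[OF d[OF that]] by simp
  have "Ck_on k S (\<lambda>x. frechet_derivative g (at x) v)" for v
    by (rule Suc.IH[of "\<lambda>x. frechet_derivative f (at x) v"]) (use Suc.prems e in auto)
  then show ?case
    using d by (auto simp: differentiable_def)
qed

text \<open>\<open>frechet_derivative\<close> is a Hilbert choice; uniqueness of derivatives on an
  open set lets the recursion be fed with any explicit formula \<open>f'\<close>. The closure proofs
  by induction on \<open>k\<close> go through this form.\<close>

lemma Ck_on_SucI:
  assumes "open S" and "\<And>x. x \<in> S \<Longrightarrow> (f has_derivative f' x) (at x)"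
    and "\<And>v. Ck_on k S (\<lambda>x. f' x v)"
  shows "Ck_on (Suc k) S f"
proof -
  have e: "frechet_derivative f (at x) = f' x" if "x \<in> S" for x
    using frechet_derivative_at[OF assms(2)[OF that]] by simp
  have "Ck_on k S (\<lambda>x. frechet_derivative f (at x) v)" for v
    by (rule Ck_on_cong[OF \<open>open S\<close>, of "\<lambda>x. f' x v"]) (use assms(3) e in auto)
  then show ?thesis
    using assms(2) by (auto simp: differentiable_def)
qed

lemma Ck_on_has_derivative:
  assumes "Ck_on (Suc k) S f" and "x \<in> S"
  shows "(f has_derivative frechet_derivative f (at x)) (at x)"
  using assms by (simp add: frechet_derivative_works)

lemma Ck_on_SucD: "Ck_on (Suc k) S f \<Longrightarrow> Ck_on k S f"
proof (induction k arbitrary: f)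
  case 0
  then show ?case
    by (simp add: continuous_at_imp_continuous_on differentiable_imp_continuous_within)
next
  case (Suc k)
  have "Ck_on k S (\<lambda>x. frechet_derivative f (at x) v)" for v
    using Suc.prems by (intro Suc.IH) simp
  then show ?case
    using Suc.prems by simp
qed

section \<open>Closure of C^k functions under algebraic operations\<close>

lemma Ck_on_const:
  assumes "open S"
  shows "Ck_on k S (\<lambda>x. c)"
proof (induction k arbitrary: c)
  case (Suc k)
  then show ?case
    by (intro Ck_on_SucI[OF assms, where f' = "\<lambda>x v. 0"]) auto
qed simp

lemma Ck_on_add:
  assumes "open S" and "Ck_on k S f" and "Ck_on k S g"
  shows "Ck_on k S (\<lambda>x. f x + g x)"
  using assms(2,3)
proof (induction k arbitrary: f g)
  case 0
  then show ?case
    by (simp add: continuous_on_add)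
next
  case (Suc k)
  then show ?case
    by (intro Ck_on_SucI[OF \<open>open S\<close>, where
          f' = "\<lambda>x v. frechet_derivative f (at x) v + frechet_derivative g (at x) v"])
       (auto intro!: has_derivative_add Ck_on_has_derivative[of k])
qed

lemma Ck_on_sum:
  assumes "open S" and "\<And>i. i \<in> I \<Longrightarrow> Ck_on k S (f i)"
  shows "Ck_on k S (\<lambda>x. \<Sum>i\<in>I. f i x)"
  using assms(2)
  by (induction I rule: infinite_finite_induct)
     (simp_all add: Ck_on_const[OF \<open>open S\<close>] Ck_on_add[OF \<open>open S\<close>])

lemma Ck_on_compose_linear:
  assumes "open S" and "bounded_linear l" and "Ck_on k S f"
  shows "Ck_on k S (\<lambda>x. l (f x))"
  using assms(3)
proof (induction k arbitrary: f)
  case 0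
  then show ?case
    by (simp add: bounded_linear.continuous_on[OF assms(2)])
next
  case (Suc k)
  then show ?case
    by (intro Ck_on_SucI[OF \<open>open S\<close>, where f' = "\<lambda>x v. l (frechet_derivative f (at x) v)"])
       (auto intro!: bounded_linear.has_derivative[OF assms(2)] Ck_on_has_derivative[of k])
qed

lemma Ck_on_linear:
  assumes "open S" and "bounded_linear l"
  shows "Ck_on k S l"
proof (cases k)
  case 0
  then show ?thesis
    using assms(2) linear_continuous_on by auto
next
  case (Suc j)
  have "Ck_on (Suc j) S l"
    by (intro Ck_on_SucI[OF \<open>open S\<close>, where f' = "\<lambda>x. l"])
       (auto simp: assms bounded_linear_imp_has_derivative Ck_on_const)
  then show ?thesis
    using Suc by simp
qed

lemma Ck_on_bilinear:
  assumes "open S" and "bounded_bilinear p" and "Ck_on k S f" and "Ck_on k S g"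
  shows "Ck_on k S (\<lambda>x. p (f x) (g x))"
  using assms(3,4)
proof (induction k arbitrary: f g)
  case 0
  then show ?case
    by (simp add: bounded_bilinear.continuous_on[OF assms(2)])
next
  case (Suc k)
  have "Ck_on k S (\<lambda>x. p (f x) (frechet_derivative g (at x) v) +
      p (frechet_derivative f (at x) v) (g x))" for v
    using Suc.prems Suc.IH[of f "\<lambda>x. frechet_derivative g (at x) v"]
      Suc.IH[of "\<lambda>x. frechet_derivative f (at x) v" g] Ck_on_SucD[of k S f] Ck_on_SucD[of k S g]
    by (intro Ck_on_add[OF \<open>open S\<close>]) auto
  then show ?case
    using Suc.prems
    by (intro Ck_on_SucI[OF \<open>open S\<close>, where f' = "\<lambda>x v. p (f x) (frechet_derivative g (at x) v) +
          p (frechet_derivative f (at x) v) (g x)"])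
       (auto intro!: bounded_bilinear.FDERIV[OF assms(2)] Ck_on_has_derivative[of k])
qed

lemma Ck_on_prod:
  fixes f :: "'i \<Rightarrow> 'a::euclidean_space \<Rightarrow> real"
  assumes "open S" and "\<And>i. i \<in> I \<Longrightarrow> Ck_on k S (f i)"
  shows "Ck_on k S (\<lambda>x. \<Prod>i\<in>I. f i x)"
  using assms(2)
  by (induction I rule: infinite_finite_induct)
     (simp_all add: Ck_on_const[OF \<open>open S\<close>] Ck_on_bilinear[OF \<open>open S\<close> bounded_bilinear_mult])

lemma Ck_on_inverse:
  fixes f :: "'a::euclidean_space \<Rightarrow> real"
  assumes "open S" and "\<And>x. x \<in> S \<Longrightarrow> f x \<noteq> 0" and "Ck_on k S f"
  shows "Ck_on k S (\<lambda>x. inverse (f x))"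
  using assms(3)
proof (induction k)
  case 0
  then show ?case
    using assms(2) by (simp add: continuous_on_inverse)
next
  case (Suc k)
  \<comment> \<open>The derivative formula contains the inverse itself, so its regularity is
    bootstrapped from the induction hypothesis.\<close>
  have i: "Ck_on k S (\<lambda>x. inverse (f x))"
    using Suc Ck_on_SucD by blast
  have "Ck_on k S (\<lambda>x. - (inverse (f x) * frechet_derivative f (at x) v * inverse (f x)))" for v
    using Suc.prems i
    by (intro Ck_on_compose_linear[OF \<open>open S\<close> bounded_linear_minus[OF bounded_linear_ident]]
          Ck_on_bilinear[OF \<open>open S\<close> bounded_bilinear_mult]) auto
  then show ?case
    using Suc.prems assms(2)
    by (intro Ck_on_SucI[OF \<open>open S\<close>, where
          f' = "\<lambda>x v. - (inverse (f x) * frechet_derivative f (at x) v * inverse (f x))"])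
       (auto intro!: Deriv.has_derivative_inverse Ck_on_has_derivative[of k])
qed

lemma Ck_on_componentwise:
  fixes f :: "'a::euclidean_space \<Rightarrow> 'b::euclidean_space"
  assumes "open S" and "\<And>b. b \<in> Basis \<Longrightarrow> Ck_on k S (\<lambda>x. f x \<bullet> b)"
  shows "Ck_on k S f"
proof -
  have "Ck_on k S (\<lambda>x. \<Sum>b\<in>Basis. (f x \<bullet> b) *\<^sub>R b)"
    using assms(2) by (intro Ck_on_sum[OF \<open>open S\<close>]
        Ck_on_compose_linear[OF \<open>open S\<close> bounded_linear_scaleR_left]) auto
  then show ?thesis
    by (simp add: euclidean_representation)
qed

text \<open>\<open>Ck_on\<close> controls derivatives in fixed directions only; expanding the moving
  direction \<open>g x\<close> in \<open>Basis\<close> reduces to these. With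
  \<open>f = g = F\<close> this is the second time derivative of a trajectory, as a function of the
  state.\<close>

lemma Ck_on_directional_derivative:
  fixes f :: "'a::euclidean_space \<Rightarrow> 'b::real_normed_vector"
  assumes "open S" and "Ck_on (Suc k) S f" and "Ck_on k S g"
  shows "Ck_on k S (\<lambda>x. frechet_derivative f (at x) (g x))"
proof (rule Ck_on_cong[OF \<open>open S\<close>])
  show "Ck_on k S (\<lambda>x. \<Sum>b\<in>Basis. (g x \<bullet> b) *\<^sub>R frechet_derivative f (at x) b)"
    using assms
    by (intro Ck_on_sum[OF \<open>open S\<close>] Ck_on_bilinear[OF \<open>open S\<close> bounded_bilinear_scaleR]
          Ck_on_compose_linear[OF \<open>open S\<close> bounded_linear_inner_left]) auto
  fix x assume "x \<in> S"
  then have "linear (frechet_derivative f (at x))"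
    using assms(2) by (simp add: linear_frechet_derivative)
  then have "frechet_derivative f (at x) (\<Sum>b\<in>Basis. (g x \<bullet> b) *\<^sub>R b) =
      (\<Sum>b\<in>Basis. (g x \<bullet> b) *\<^sub>R frechet_derivative f (at x) b)"
    by (simp add: linear_sum linear_scale)
  then show "(\<Sum>b\<in>Basis. (g x \<bullet> b) *\<^sub>R frechet_derivative f (at x) b) =
      frechet_derivative f (at x) (g x)"
    by (simp add: euclidean_representation)
qed

text \<open>For nonempty \<open>K\<close>, \<open>K'\<close> is the closed neighbourhood of radius
  \<open>\<delta>\<close>. As it is compact, a bound on it serves all balls around points of
  \<open>K\<close> at once, which yields constants that do not depend on the starting value.\<close>

lemma compact_nbhd:
  fixes K :: "'a::euclidean_space set"
  assumes "open S" and "compact K" and "K \<subseteq> S"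
  obtains \<delta> K' where "\<delta> > 0" and "compact K'" and "K' \<subseteq> S" and "\<And>c. c \<in> K \<Longrightarrow> cball c \<delta> \<subseteq> K'"
proof (cases "K = {}")
  case True
  then show ?thesis
    using that[of 1 "{}"] by simp
next
  case False
  obtain e where e: "e > 0" "{x. infdist x K \<le> e} \<subseteq> S"
    using compact_in_open_separated[OF False assms(2,1,3)] by blast
  show ?thesis
  proof (rule that)
    show "compact {x. infdist x K \<le> e}"
      using compact_infdist_le[OF False assms(2)] e by simp
    show "cball c e \<subseteq> {x. infdist x K \<le> e}" if "c \<in> K" for c
      using that infdist_le2[OF that] by (auto simp: dist_commute)
  qed (use e in auto)
qed

text \<open>The mean value inequality wants a convex domain, and \<open>K\<close> need not be
  convex. One derivative bound over \<open>K\<close> serves every convex subset, in practice a ball;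
  \<open>L\<close> adds up bounds for the basis directions.\<close>

lemma Ck_on_lipschitz:
  fixes f :: "'a::euclidean_space \<Rightarrow> 'b::real_normed_vector"
  assumes "Ck_on 1 S f" and "compact K" and "K \<subseteq> S"
  obtains L where "L \<ge> 0" and "\<And>A. convex A \<Longrightarrow> A \<subseteq> K \<Longrightarrow> L-lipschitz_on A f"
proof -
  have "\<exists>B. \<forall>x\<in>K. norm (frechet_derivative f (at x) b) \<le> B" for b
  proof -
    have "continuous_on K (\<lambda>x. frechet_derivative f (at x) b)"
      using assms(1,3) continuous_on_subset[of S "\<lambda>x. frechet_derivative f (at x) b" K] by simp
    then have "bounded ((\<lambda>x. frechet_derivative f (at x) b) ` K)"
      using assms(2) compact_continuous_image compact_imp_bounded by blast
    then show ?thesis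
      by (auto simp: bounded_iff)
  qed
  then obtain B where B: "\<And>b x. x \<in> K \<Longrightarrow> norm (frechet_derivative f (at x) b) \<le> B b"
    by metis
  define L where "L = (\<Sum>b\<in>Basis. \<bar>B b\<bar>)"
  have on: "onorm (frechet_derivative f (at x)) \<le> L" if "x \<in> K" for x
  proof (rule onorm_le)
    fix v :: 'a
    have l: "linear (frechet_derivative f (at x))"
      using assms that by (auto simp: linear_frechet_derivative)
    have "norm (frechet_derivative f (at x) v) =
        norm (\<Sum>b\<in>Basis. (v \<bullet> b) *\<^sub>R frechet_derivative f (at x) b)"
      using l by (subst euclidean_representation[of v, symmetric]) (simp only: linear_sum linear_scale)
    also have "\<dots> \<le> (\<Sum>b\<in>Basis. norm ((v \<bullet> b) *\<^sub>R frechet_derivative f (at x) b))"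
      by (rule norm_sum)
    also have "\<dots> \<le> (\<Sum>b\<in>Basis. \<bar>B b\<bar> * norm v)"
    proof (rule sum_mono)
      fix b :: 'a assume "b \<in> Basis"
      then have "\<bar>v \<bullet> b\<bar> * norm (frechet_derivative f (at x) b) \<le> norm v * \<bar>B b\<bar>"
        using B[OF that, of b] by (intro mult_mono) (auto simp: Basis_le_norm)
      then show "norm ((v \<bullet> b) *\<^sub>R frechet_derivative f (at x) b) \<le> \<bar>B b\<bar> * norm v"
        by (simp add: mult.commute)
    qed
    finally show "norm (frechet_derivative f (at x) v) \<le> L * norm v"
      by (simp add: L_def sum_distrib_right)
  qed
  have L0: "L \<ge> 0"
    by (simp add: L_def sum_nonneg)
  show ?thesis
  proof (rule that[OF L0])
    fix A :: "'a set" assume A: "convex A" "A \<subseteq> K"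
    have d: "(f has_derivative frechet_derivative f (at x)) (at x within A)" if "x \<in> A" for x
      using assms that A
      by (intro has_derivative_at_withinI[OF Ck_on_has_derivative[of 0 S]]) auto
    show "L-lipschitz_on A f"
    proof (rule lipschitz_onI[OF _ L0])
      fix x y assume "x \<in> A" "y \<in> A"
      then show "dist (f x) (f y) \<le> L * dist x y"
        using differentiable_bound[OF A(1) d, of L] on A by (auto simp: dist_norm)
    qed
  qed
qed

lemma continuous_on_compact_norm_bound:
  fixes f :: "'a::topological_space \<Rightarrow> 'b::real_normed_vector"
  assumes "continuous_on K f" and "compact K"
  obtains B where "B \<ge> 0" and "\<And>x. x \<in> K \<Longrightarrow> norm (f x) \<le> B"
proof -
  have "bounded (f ` K)"
    using assms compact_continuous_image compact_imp_bounded by blast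
  then show ?thesis
    using that by (metis bounded_pos image_eqI less_imp_le)
qed

section \<open>Convergence of implicit one-step methods\<close>

text \<open>
  A step of size \<open>h\<close> is given by \<open>v = u + h \<Psi> u v\<close>; the relation \<open>W\<close> is the domain of \<open>\<Psi>\<close>.
\<close>

definition increment_bounds ::
  "('a::real_normed_vector \<Rightarrow> 'a \<Rightarrow> bool) \<Rightarrow> ('a \<Rightarrow> 'a \<Rightarrow> 'a) \<Rightarrow> 'a set \<Rightarrow>
   real \<Rightarrow> real \<Rightarrow> real \<Rightarrow> bool" where
  "increment_bounds W \<Psi> K \<delta> B L \<longleftrightarrow> 0 < \<delta> \<and> 0 \<le> B \<and> 0 \<le> L \<and>
     (\<forall>c\<in>K. \<forall>u\<in>cball c \<delta>. \<forall>v\<in>cball c \<delta>. W u v \<and> norm (\<Psi> u v) \<le> B \<and>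
        (\<forall>u'\<in>cball c \<delta>. \<forall>v'\<in>cball c \<delta>.
           norm (\<Psi> u v - \<Psi> u' v') \<le> L * (norm (u - u') + norm (v - v'))))"

text \<open>Consistency of order \<open>p\<close>, measured by inserting the exact solution into the
  step equation. The bound on \<open>w h - w 0\<close> keeps the exact end point inside the ball
  where \<open>increment_bounds\<close> can be applied.\<close>

definition defect_bounds ::
  "('a::real_normed_vector \<Rightarrow> 'a) \<Rightarrow> 'a set \<Rightarrow> ('a \<Rightarrow> 'a \<Rightarrow> 'a) \<Rightarrow> nat \<Rightarrow> 'a set \<Rightarrow>
   real \<Rightarrow> real \<Rightarrow> real \<Rightarrow> bool" where
  "defect_bounds F S \<Psi> p K h1 B C \<longleftrightarrow> 0 < h1 \<and> 0 \<le> B \<and> 0 \<le> C \<and>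
     (\<forall>h w. 0 < h \<and> h \<le> h1 \<and> w 0 \<in> K \<and> trajectory F S {0..h} w \<longrightarrow>
        norm (w h - w 0) \<le> B * h \<and>
        norm (w h - w 0 - h *\<^sub>R \<Psi> (w 0) (w h)) \<le> C * h ^ (p + 1))"

lemma increment_boundsD:
  assumes "increment_bounds W \<Psi> K \<delta> B L"
  shows "0 < \<delta>" and "0 \<le> B" and "0 \<le> L"
    and "c \<in> K \<Longrightarrow> u \<in> cball c \<delta> \<Longrightarrow> v \<in> cball c \<delta> \<Longrightarrow> W u v"
    and "c \<in> K \<Longrightarrow> u \<in> cball c \<delta> \<Longrightarrow> v \<in> cball c \<delta> \<Longrightarrow> norm (\<Psi> u v) \<le> B"
    and "c \<in> K \<Longrightarrow> u \<in> cball c \<delta> \<Longrightarrow> v \<in> cball c \<delta> \<Longrightarrow> u' \<in> cball c \<delta> \<Longrightarrow> v' \<in> cball c \<delta> \<Longrightarrow>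
      norm (\<Psi> u v - \<Psi> u' v') \<le> L * (norm (u - u') + norm (v - v'))"
  using assms unfolding increment_bounds_def by blast+

text \<open>Banach's theorem with factor 1/2 on \<open>cball u (\<delta> / 4)\<close>. In the global
  estimate \<open>c\<close> is a point of the exact solution and \<open>u\<close> an approximation
  to it; starting at distance \<open>\<delta> / 2\<close>, the iteration stays within
  \<open>3 * \<delta> / 4\<close> of \<open>c\<close>, where the bounds around \<open>c\<close>
  apply.\<close>

lemma implicit_step_exists:
  fixes u :: "'a::banach"
  assumes inc: "increment_bounds W \<Psi> K \<delta> B L" and "c \<in> K" and u: "u \<in> cball c (\<delta> / 2)"
    and "0 \<le> h" and "h * L \<le> 1 / 2" and "h * B \<le> \<delta> / 4"
  shows "\<exists>v\<in>ball u (\<delta> / 2). W u v \<and> v = u + h *\<^sub>R \<Psi> u v"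
proof -
  note b = increment_boundsD[OF inc]
  have sub: "cball u (\<delta> / 4) \<subseteq> cball c \<delta>"
  proof
    fix v assume "v \<in> cball u (\<delta> / 4)"
    then show "v \<in> cball c \<delta>"
      using u dist_triangle[of c v u] b(1) by auto
  qed
  have uc: "u \<in> cball c \<delta>"
    using u b(1) by auto
  have "\<exists>!v. v \<in> cball u (\<delta> / 4) \<and> u + h *\<^sub>R \<Psi> u v = v"
  proof (rule Banach_fix[where c = "1 / 2"])
    show "complete (cball u (\<delta> / 4))"
      by (simp add: complete_eq_closed)
    show "cball u (\<delta> / 4) \<noteq> {}"
      using b(1) by simp
    show "(\<lambda>v. u + h *\<^sub>R \<Psi> u v) ` cball u (\<delta> / 4) \<subseteq> cball u (\<delta> / 4)"
    proof clarify
      fix v assume "v \<in> cball u (\<delta> / 4)"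
      then have "norm (\<Psi> u v) \<le> B"
        using b(5)[OF \<open>c \<in> K\<close> uc] sub by blast
      then have "h * norm (\<Psi> u v) \<le> \<delta> / 4"
        using mult_left_mono[of "norm (\<Psi> u v)" B h] assms by linarith
      then show "u + h *\<^sub>R \<Psi> u v \<in> cball u (\<delta> / 4)"
        using \<open>0 \<le> h\<close> by (simp add: dist_norm)
    qed
    fix v v' assume "v \<in> cball u (\<delta> / 4)" "v' \<in> cball u (\<delta> / 4)"
    then have "v \<in> cball c \<delta>" "v' \<in> cball c \<delta>"
      using sub by blast+
    then have "norm (\<Psi> u v - \<Psi> u v') \<le> L * norm (v - v')"
      using b(6)[OF \<open>c \<in> K\<close> uc _ uc, of v v'] by simp
    then have "h * norm (\<Psi> u v - \<Psi> u v') \<le> h * L * norm (v - v')"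
      using mult_left_mono[OF _ \<open>0 \<le> h\<close>] by (simp add: mult.assoc)
    also have "\<dots> \<le> 1 / 2 * norm (v - v')"
      using assms by (intro mult_right_mono) auto
    finally show "dist (u + h *\<^sub>R \<Psi> u v) (u + h *\<^sub>R \<Psi> u v') \<le> 1 / 2 * dist v v'"
      using \<open>0 \<le> h\<close> by (simp add: dist_norm flip: scaleR_diff_right)
  qed auto
  then obtain v where v: "v \<in> cball u (\<delta> / 4)" "u + h *\<^sub>R \<Psi> u v = v"
    by blast
  moreover have "W u v"
    using b(4)[OF \<open>c \<in> K\<close> uc] sub v by blast
  ultimately show ?thesis
    using b(1) by (intro bexI[of _ v]) auto
qed

text \<open>Subtracting the two equations bounds the new error \<open>e'\<close> by
  \<open>e + s * (e + e') + d\<close>, and the implicit \<open>e'\<close> is absorbed on the left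
  because \<open>s \<le> 1 / 2\<close>. If \<open>u = a\<close> and \<open>b\<close> is a second
  solution of the step equation, the right-hand side is zero: the estimate also yields
  uniqueness.\<close>

lemma implicit_step_error:
  assumes inc: "increment_bounds W \<Psi> K \<delta> B L" and "c \<in> K"
    and "u \<in> cball c \<delta>" and "v \<in> cball c \<delta>" and "a \<in> cball c \<delta>" and "b \<in> cball c \<delta>"
    and "0 \<le> h" and hL: "h * L \<le> 1 / 2" and v: "v = u + h *\<^sub>R \<Psi> u v"
  shows "norm (v - b) \<le> (1 + 4 * (h * L)) * norm (u - a) + 2 * norm (b - a - h *\<^sub>R \<Psi> a b)"
proof -
  define d where "d = norm (b - a - h *\<^sub>R \<Psi> a b)"
  define e where "e = norm (u - a)"
  define e' where "e' = norm (v - b)"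
  define s where "s = h * L"
  have s: "0 \<le> s" "s \<le> 1 / 2"
    using assms increment_boundsD(3)[OF inc] by (auto simp: s_def)
  have "norm (\<Psi> u v - \<Psi> a b) \<le> L * (e + e')"
    using increment_boundsD(6)[OF inc \<open>c \<in> K\<close>] assms by (simp add: e_def e'_def)
  then have p: "norm (h *\<^sub>R (\<Psi> u v - \<Psi> a b)) \<le> s * (e + e')"
    using mult_left_mono[of _ _ h] \<open>0 \<le> h\<close> by (simp add: s_def mult.assoc)
  have "v - b = (u - a) + h *\<^sub>R (\<Psi> u v - \<Psi> a b) - (b - a - h *\<^sub>R \<Psi> a b)"
    using v by (simp add: algebra_simps)
  then have "e' \<le> e + norm (h *\<^sub>R (\<Psi> u v - \<Psi> a b)) + d"
    unfolding e'_def d_def e_def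
    by (simp only:) (rule order_trans[OF norm_triangle_ineq4 add_right_mono[OF norm_triangle_ineq]])
  then have 1: "(1 - s) * e' \<le> (1 + s) * e + d"
    using p by (simp add: algebra_simps)
  \<comment> \<open>These are the slacks in \<open>(1 + s) / (1 - s) \<le> 1 + 4 * s\<close> and
    \<open>1 / (1 - s) \<le> 2\<close>, cleared of denominators.\<close>
  have "0 \<le> s * e * (2 - 4 * s)" "0 \<le> d * (1 - 2 * s)"
    using s by (simp_all add: e_def d_def)
  then have "(1 + s) * e + d \<le> (1 - s) * ((1 + 4 * s) * e + 2 * d)"
    by (simp add: algebra_simps)
  then have "(1 - s) * e' \<le> (1 - s) * ((1 + 4 * s) * e + 2 * d)"
    using 1 by linarith
  then show ?thesis
    using s by (simp add: d_def e_def e'_def s_def)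
qed

section \<open>Restarted trajectories and accumulation of errors\<close>

lemma trajectory_shift:
  assumes "trajectory F S {0..T} w" and "0 \<le> a" and "a + h \<le> T"
  shows "trajectory F S {0..h} (\<lambda>t. w (a + t))"
proof -
  have "((\<lambda>t. w (a + t)) has_vector_derivative F (w (a + t))) (at t within {0..h})"
    if t: "t \<in> {0..h}" for t
  proof -
    have "(w has_vector_derivative F (w (a + t))) (at (a + t) within {0..T})"
      using assms t by (auto simp: trajectory_def)
    then have "(w has_vector_derivative F (w (a + t))) (at (a + t) within (\<lambda>t. a + t) ` {0..h})"
      by (rule has_vector_derivative_within_subset) (use assms in auto)
    moreover have "((\<lambda>t. a + t) has_vector_derivative 1) (at t within {0..h})"
      by (auto intro!: derivative_eq_intros)
    ultimately show ?thesis
      using vector_diff_chain_within[of "\<lambda>t. a + t" 1 t "{0..h}" w] by (simp add: o_def)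
  qed
  then show ?thesis
    using assms by (auto simp: trajectory_def is_interval_cc)
qed

lemma trajectory_continuous_on:
  assumes "trajectory F S I w"
  shows "continuous_on I w"
  using assms unfolding trajectory_def continuous_on_eq_continuous_within
  by (meson has_vector_derivative_continuous)

text \<open>Each of the \<open>n\<close> contributions \<open>b\<close> is amplified by at most
  \<open>(1 + a) ^ n\<close>. This is cruder than summing the geometric series, but avoids dividing
  by \<open>a\<close>, which is zero when the Lipschitz constant is.\<close>

lemma discrete_gronwall:
  fixes e :: "nat \<Rightarrow> real"
  assumes "e 0 \<le> 0" and "0 \<le> a" and "0 \<le> b"
    and step: "\<And>k. k < n \<Longrightarrow> e (Suc k) \<le> (1 + a) * e k + b"
  shows "e n \<le> b * real n * exp (a * real n)"
proof -
  have "e k \<le> b * real k * (1 + a) ^ k" if "k \<le> n" for k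
    using that
  proof (induction k)
    case 0
    then show ?case
      using assms by simp
  next
    case (Suc k)
    have "e (Suc k) \<le> (1 + a) * e k + b"
      using Suc.prems by (intro step) simp
    also have "\<dots> \<le> (1 + a) * (b * real k * (1 + a) ^ k) + b * (1 + a) ^ Suc k"
      using Suc \<open>0 \<le> a\<close> \<open>0 \<le> b\<close> mult_left_mono[OF one_le_power[of "1 + a" "Suc k"], of b]
      by (intro add_mono mult_left_mono) auto
    also have "\<dots> = b * real (Suc k) * (1 + a) ^ Suc k"
      by (simp add: algebra_simps)
    finally show ?case .
  qed
  then have "e n \<le> b * real n * (1 + a) ^ n"
    by simp
  also have "(1 + a) ^ n \<le> exp a ^ n"
    using \<open>0 \<le> a\<close> by (intro power_mono exp_ge_add_one_self) auto
  then have "b * real n * (1 + a) ^ n \<le> b * real n * exp (a * real n)"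
    using \<open>0 \<le> b\<close> by (intro mult_left_mono) (auto simp: exp_of_nat2_mult)
  finally show ?thesis .
qed

lemma local_error_orderI:
  fixes F :: "'a::euclidean_space \<Rightarrow> 'a"
  assumes step: "\<And>h u v. 0 < h \<Longrightarrow> \<Phi> h u v \<longleftrightarrow> W u v \<and> v = u + h *\<^sub>R \<Psi> u v"
    and inc: "\<And>K. compact K \<Longrightarrow> K \<subseteq> S \<Longrightarrow> \<exists>\<delta> B L. increment_bounds W \<Psi> K \<delta> B L"
    and def: "\<And>K. compact K \<Longrightarrow> K \<subseteq> S \<Longrightarrow> \<exists>h1 B C. defect_bounds F S \<Psi> p K h1 B C"
  shows "local_error_order F S \<Phi> p"
  unfolding local_error_order_def
proof (intro allI impI)
  fix K assume K: "compact K \<and> K \<subseteq> S"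
  obtain \<delta> B L where i: "increment_bounds W \<Psi> K \<delta> B L"
    using inc K by blast
  obtain h1 B' C where d: "defect_bounds F S \<Psi> p K h1 B' C"
    using def K by blast
  note b = increment_boundsD[OF i]
  have h1: "0 < h1" "0 \<le> B'" "0 \<le> C"
    using d by (auto simp: defect_bounds_def)
  \<comment> \<open>In this order the entries ensure the defect bound, the contraction, that the
    fixed point iteration stays in its ball, and that the exact end point stays near
    \<open>u\<close>. The added ones avoid division by zero.\<close>
  define h0 where "h0 = Min {h1, 1 / (2 * (L + 1)), \<delta> / (4 * (B + 1)), \<delta> / (4 * (B' + 1))}"
  have "0 < h0"
    using b h1 by (simp add: h0_def)
  moreover have "(\<exists>!v. v \<in> ball u (\<delta> / 2) \<and> \<Phi> h u v) \<and>
      (\<forall>v w. v \<in> ball u (\<delta> / 2) \<and> \<Phi> h u v \<and> trajectory F S {0..h} w \<and> w 0 = u \<longrightarrow>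
         norm (v - w h) \<le> (2 * C) * h ^ (p + 1))"
    if h: "0 < h \<and> h \<le> h0 \<and> u \<in> K" for h u
  proof -
    have "h \<le> h1" "h \<le> 1 / (2 * (L + 1))" "h \<le> \<delta> / (4 * (B + 1))" "h \<le> \<delta> / (4 * (B' + 1))"
      using h by (simp_all add: h0_def)
    then have hs: "h \<le> h1" "h * L \<le> 1 / 2" "h * B \<le> \<delta> / 4" "B' * h \<le> \<delta> / 4"
      using b h1 h by (simp_all add: field_simps)
    have u: "u \<in> K" "u \<in> cball u \<delta>" "u \<in> cball u (\<delta> / 2)"
      using h b(1) by auto
    have sub: "ball u (\<delta> / 2) \<subseteq> cball u \<delta>"
      using b(1) by auto
    have err: "norm (v - w) \<le> 2 * norm (w - u - h *\<^sub>R \<Psi> u w)"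
      if "v \<in> cball u \<delta>" "w \<in> cball u \<delta>" "\<Phi> h u v" for v w
      using implicit_step_error[OF i u(1,2) that(1) u(2) that(2) _ hs(2)] that step h by auto
    have "\<exists>v. v \<in> ball u (\<delta> / 2) \<and> \<Phi> h u v"
      using implicit_step_exists[OF i u(1,3) _ hs(2,3)] step h by auto
    moreover have "v = v'" if "v \<in> ball u (\<delta> / 2) \<and> \<Phi> h u v" "v' \<in> ball u (\<delta> / 2) \<and> \<Phi> h u v'" for v v'
    proof -
      have "v' - u - h *\<^sub>R \<Psi> u v' = 0"
        using that(2) step h by (simp add: algebra_simps)
      moreover have "v \<in> cball u \<delta>" "v' \<in> cball u \<delta>"
        using that sub by blast+
      ultimately have "norm (v - v') \<le> 2 * 0"
        using err[of v v'] that by simp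
      then show ?thesis
        by simp
    qed
    moreover have "norm (v - w h) \<le> (2 * C) * h ^ (p + 1)"
      if "v \<in> ball u (\<delta> / 2) \<and> \<Phi> h u v \<and> trajectory F S {0..h} w \<and> w 0 = u" for v w
    proof -
      have w: "norm (w h - u) \<le> B' * h" "norm (w h - u - h *\<^sub>R \<Psi> u (w h)) \<le> C * h ^ (p + 1)"
        using d h hs that unfolding defect_bounds_def by blast+
      then have "w h \<in> cball u \<delta>"
        using hs(4) b(1) by (auto simp: dist_norm norm_minus_commute)
      then show ?thesis
        using err[of v "w h"] w that sub by auto
    qed
    ultimately show ?thesis
      by blast
  qed
  ultimately show "\<exists>h0>0. \<exists>\<delta>>0. \<exists>C. \<forall>h u. 0 < h \<and> h \<le> h0 \<and> u \<in> K \<longrightarrow>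
          (\<exists>!v. v \<in> ball u \<delta> \<and> \<Phi> h u v) \<and>
          (\<forall>v w. v \<in> ball u \<delta> \<and> \<Phi> h u v \<and> trajectory F S {0..h} w \<and> w 0 = u \<longrightarrow>
             norm (v - w h) \<le> C * h ^ (p + 1))"
    using b(1) by (intro exI[of _ h0] conjI exI[of _ "\<delta> / 2"] exI[of _ "2 * C"]) auto
qed

text \<open>The step estimate applies only near the exact solution, and nearness is what has to be
  shown. Strong induction breaks the circle: the bound for earlier indices, at most
  \<open>\<delta> / 4\<close> by the last condition on \<open>h\<close>, keeps \<open>u k\<close>
  near the trajectory, and the restriction to steps shorter than \<open>\<delta> / 2\<close> keeps
  \<open>u (Suc k)\<close> in the same ball.\<close>

lemma numerical_solution_error:
  fixes F :: "'a::euclidean_space \<Rightarrow> 'a"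
  assumes step: "\<And>u v. \<Phi> h u v \<Longrightarrow> v = u + h *\<^sub>R \<Psi> u v"
    and i: "increment_bounds W \<Psi> K \<delta> B L" and d: "defect_bounds F S \<Psi> p K h1 B' C"
    and w: "trajectory F S {0..T} w" and wK: "w ` {0..T} \<subseteq> K"
    and h: "0 < h" "h \<le> h1" "h * L \<le> 1 / 2" "B' * h \<le> \<delta> / 4"
      "2 * C * T * exp (4 * L * T) * h ^ p \<le> \<delta> / 4"
    and "real N * h \<le> T" and u: "u 0 = w 0" "numerical_solution \<Phi> h N u"
      "\<And>k. k < N \<Longrightarrow> u (Suc k) \<in> ball (u k) (\<delta> / 2)"
    and "k \<le> N"
  shows "norm (u k - w (real k * h)) \<le> 2 * C * T * exp (4 * L * T) * h ^ p"
  using \<open>k \<le> N\<close>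
proof (induction k rule: less_induct)
  case (less n)
  note b = increment_boundsD[OF i]
  have C: "0 \<le> C"
    using d by (simp add: defect_bounds_def)
  have D: "norm (w h - w 0) \<le> B' * h \<and> norm (w h - w 0 - h *\<^sub>R \<Psi> (w 0) (w h)) \<le> C * h ^ (p + 1)"
    if "0 < h" "h \<le> h1" "w 0 \<in> K" "trajectory F S {0..h} w" for h w
    using d that unfolding defect_bounds_def by blast
  have T: "0 \<le> T"
    using \<open>real N * h \<le> T\<close> h(1) by (meson mult_nonneg_nonneg of_nat_0_le_iff less_imp_le order_trans)
  have "norm (u n - w (real n * h)) \<le> 2 * C * h ^ (p + 1) * real n * exp (4 * (h * L) * real n)"
  proof (rule discrete_gronwall[where e = "\<lambda>k. norm (u k - w (real k * h))"])
    fix k assume "k < n"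
    define a where "a = w (real k * h)"
    define c where "c = w (real (Suc k) * h)"
    have "real (Suc k) * h \<le> real N * h"
      using \<open>k < n\<close> \<open>n \<le> N\<close> h(1) by (intro mult_right_mono) auto
    then have kT: "real k * h + h \<le> T"
      using \<open>real N * h \<le> T\<close> by (simp add: algebra_simps)
    then have "real k * h \<in> {0..T}"
      using h(1) by auto
    then have aK: "a \<in> K"
      using wK by (auto simp: a_def)
    have "trajectory F S {0..h} (\<lambda>t. w (real k * h + t))"
      using trajectory_shift[OF w _ kT] h(1) by simp
    then have "norm (w (real k * h + h) - w (real k * h + 0)) \<le> B' * h \<and>
        norm (w (real k * h + h) - w (real k * h + 0) -
          h *\<^sub>R \<Psi> (w (real k * h + 0)) (w (real k * h + h))) \<le> C * h ^ (p + 1)"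
      using D[of h "\<lambda>t. w (real k * h + t)"] h aK by (simp add: a_def)
    then have ac: "norm (c - a) \<le> B' * h" "norm (c - a - h *\<^sub>R \<Psi> a c) \<le> C * h ^ (p + 1)"
      by (simp_all add: a_def c_def algebra_simps)
    have "norm (u k - a) \<le> 2 * C * T * exp (4 * L * T) * h ^ p"
      unfolding a_def using \<open>k < n\<close> less by simp
    then have uk: "norm (u k - a) \<le> \<delta> / 4"
      using h(5) by linarith
    have suk: "dist (u k) (u (Suc k)) < \<delta> / 2"
      using u(3)[of k] \<open>k < n\<close> \<open>n \<le> N\<close> by simp
    have mem: "u k \<in> cball a \<delta>" "u (Suc k) \<in> cball a \<delta>" "a \<in> cball a \<delta>" "c \<in> cball a \<delta>"
      using uk suk ac(1) h(4) b(1) dist_triangle[of a "u (Suc k)" "u k"]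
      by (auto simp: dist_norm norm_minus_commute)
    have "\<Phi> h (u k) (u (Suc k))"
      using u(2) \<open>k < n\<close> \<open>n \<le> N\<close> by (simp add: numerical_solution_def)
    then have "norm (u (Suc k) - c) \<le> (1 + 4 * (h * L)) * norm (u k - a) + 2 * norm (c - a - h *\<^sub>R \<Psi> a c)"
      using implicit_step_error[OF i aK mem _ h(3)] h(1) step by simp
    then show "norm (u (Suc k) - w (real (Suc k) * h)) \<le>
        (1 + 4 * (h * L)) * norm (u k - w (real k * h)) + 2 * C * h ^ (p + 1)"
      using ac(2) by (simp add: a_def c_def)
  qed (use u(1) h b C in auto)
  \<comment> \<open>One factor \<open>h\<close> of the local defect is spent on the number of steps,
    since \<open>real n * h \<le> T\<close>.\<close>
  also have "\<dots> = 2 * C * h ^ p * (real n * h) * exp (4 * L * (real n * h))"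
    by (simp add: algebra_simps)
  also have "\<dots> \<le> 2 * C * h ^ p * T * exp (4 * L * T)"
  proof -
    have "real n * h \<le> real N * h"
      using \<open>n \<le> N\<close> h(1) by (intro mult_right_mono) auto
    then have "real n * h \<le> T"
      using \<open>real N * h \<le> T\<close> by linarith
    then show ?thesis
      using h(1) b(3) C T mult_left_mono[OF _ b(3), of "real n * h" T]
      by (intro mult_mono mult_left_mono) (auto intro!: mult_nonneg_nonneg)
  qed
  finally show ?case
    by (simp add: algebra_simps)
qed

lemma global_error_orderI:
  fixes F :: "'a::euclidean_space \<Rightarrow> 'a"
  assumes step: "\<And>h u v. 0 < h \<Longrightarrow> \<Phi> h u v \<longleftrightarrow> W u v \<and> v = u + h *\<^sub>R \<Psi> u v"
    and inc: "\<And>K. compact K \<Longrightarrow> K \<subseteq> S \<Longrightarrow> \<exists>\<delta> B L. increment_bounds W \<Psi> K \<delta> B L"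
    and def: "\<And>K. compact K \<Longrightarrow> K \<subseteq> S \<Longrightarrow> \<exists>h1 B C. defect_bounds F S \<Psi> p K h1 B C"
    and "p > 0"
  shows "global_error_order F S \<Phi> p"
  unfolding global_error_order_def
proof (intro allI impI)
  fix T w assume w: "trajectory F S {0..T} w"
  define K where "K = w ` {0..T}"
  have K: "compact K" "K \<subseteq> S"
    unfolding K_def using compact_continuous_image[OF trajectory_continuous_on[OF w]] w
    by (auto simp: trajectory_def)
  obtain \<delta> B L where i: "increment_bounds W \<Psi> K \<delta> B L"
    using inc K by blast
  obtain h1 B' C where d: "defect_bounds F S \<Psi> p K h1 B' C"
    using def K by blast
  note b = increment_boundsD[OF i]
  have h1: "0 < h1" "0 \<le> B'" "0 \<le> C"
    using d by (auto simp: defect_bounds_def)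
  define A where "A = 2 * C * T * exp (4 * L * T)"
  \<comment> \<open>The entry \<open>1\<close> and the last entry give
    \<open>A * h ^ p \<le> \<bar>A\<bar> * h \<le> \<delta> / 4\<close>, as
    \<open>numerical_solution_error\<close> demands. The absolute value is there because
    \<open>T\<close>, and with it \<open>A\<close>, may be negative.\<close>
  define h0 where "h0 = Min {1, h1, 1 / (2 * (L + 1)), \<delta> / (4 * (B + 1)), \<delta> / (4 * (B' + 1)),
      \<delta> / (4 * (\<bar>A\<bar> + 1))}"
  have "0 < h0"
    using b h1 by (simp add: h0_def)
  moreover have "(\<exists>u. u 0 = w 0 \<and> numerical_solution \<Phi> h N u \<and>
        (\<forall>k<N. u (Suc k) \<in> ball (u k) (\<delta> / 2))) \<and>
      (\<forall>u. u 0 = w 0 \<and> numerical_solution \<Phi> h N u \<and> (\<forall>k<N. u (Suc k) \<in> ball (u k) (\<delta> / 2)) \<longrightarrow>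
        (\<forall>k\<le>N. norm (u k - w (real k * h)) \<le> A * h ^ p))"
    if h: "0 < h \<and> h \<le> h0 \<and> real N * h \<le> T" for h N
  proof -
    have le: "h \<le> 1" "h \<le> h1" "h \<le> 1 / (2 * (L + 1))" "h \<le> \<delta> / (4 * (B + 1))"
        "h \<le> \<delta> / (4 * (B' + 1))" "h \<le> \<delta> / (4 * (\<bar>A\<bar> + 1))"
      using h by (simp_all add: h0_def)
    have hs: "0 < h" "h \<le> h1" "h * L \<le> 1 / 2" "B' * h \<le> \<delta> / 4"
      using le b h1 h by (simp_all add: field_simps)
    have hB: "h * B \<le> \<delta> / 4"
      using le b h by (simp add: field_simps)
    have "A * h ^ p \<le> \<bar>A\<bar> * h"
      using power_decreasing[of 1 p h] \<open>p > 0\<close> le h by (intro mult_mono) auto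
    also have "\<bar>A\<bar> * h \<le> \<delta> / 4"
      using le(6) h by (simp add: field_simps)
    finally have hA: "A * h ^ p \<le> \<delta> / 4" .
    have err: "norm (u k - w (real k * h)) \<le> A * h ^ p"
      if "u 0 = w 0" "numerical_solution \<Phi> h n u" "\<And>k. k < n \<Longrightarrow> u (Suc k) \<in> ball (u k) (\<delta> / 2)"
        "k \<le> n" "real n * h \<le> T" for u k n
      unfolding A_def
      by (rule numerical_solution_error[OF _ i d w _ hs _ that(5,1,2,3,4)])
         (use step hs(1) hA in \<open>auto simp: K_def A_def\<close>)
    \<comment> \<open>Existence and error bound are interleaved: a solution of \<open>n\<close>
      steps is still within \<open>\<delta> / 4\<close> of the trajectory, so one more step can be
      solved from its last point.\<close>
    have "\<exists>u. u 0 = w 0 \<and> numerical_solution \<Phi> h n u \<and> (\<forall>k<n. u (Suc k) \<in> ball (u k) (\<delta> / 2))"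
      if "n \<le> N" for n
      using that
    proof (induction n)
      case 0
      then show ?case
        by (auto simp: numerical_solution_def)
    next
      case (Suc n)
      then obtain u where u: "u 0 = w 0" "numerical_solution \<Phi> h n u"
          "\<And>k. k < n \<Longrightarrow> u (Suc k) \<in> ball (u k) (\<delta> / 2)"
        by auto
      have "real n * h \<le> real N * h"
        using Suc.prems hs(1) by (intro mult_right_mono) auto
      then have nT: "real n * h \<le> T"
        using h by linarith
      then have "norm (u n - w (real n * h)) \<le> \<delta> / 4"
        using err[OF u, of n] hA by simp
      then have "u n \<in> cball (w (real n * h)) (\<delta> / 2)"
        using b(1) by (simp add: dist_norm norm_minus_commute)
      moreover have "w (real n * h) \<in> K"
        using nT hs(1) by (auto simp: K_def)
      ultimately obtain v where v: "v \<in> ball (u n) (\<delta> / 2)" "\<Phi> h (u n) v"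
        using implicit_step_exists[OF i _ _ _ hs(3) hB] step hs(1) by (metis less_imp_le)
      show ?case
        using u v
        by (intro exI[of _ "u(Suc n := v)"]) (auto simp: numerical_solution_def less_Suc_eq)
    qed
    then show ?thesis
      using err h by blast
  qed
  ultimately show "\<exists>h0>0. \<exists>\<delta>>0. \<exists>C. \<forall>h K. 0 < h \<and> h \<le> h0 \<and> real K * h \<le> T \<longrightarrow>
          (\<exists>u. u 0 = w 0 \<and> numerical_solution \<Phi> h K u \<and>
             (\<forall>k<K. u (Suc k) \<in> ball (u k) \<delta>)) \<and>
          (\<forall>u. u 0 = w 0 \<and> numerical_solution \<Phi> h K u \<and>
             (\<forall>k<K. u (Suc k) \<in> ball (u k) \<delta>) \<longrightarrow>
             (\<forall>k\<le>K. norm (u k - w (real k * h)) \<le> C * h ^ p))"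
    using b(1) by (intro exI[of _ h0] conjI exI[of _ "\<delta> / 2"] exI[of _ A]) auto
qed

section \<open>The implicit midpoint method\<close>

lemma midpoint_in_convex:
  fixes x y :: "'a::real_normed_vector"
  assumes "convex A" and "x \<in> A" and "y \<in> A"
  shows "midpoint x y \<in> A"
  using midpoints_in_convex_hull[of x A y] assms by (simp add: hull_same)

lemma norm_midpoint_diff_le:
  fixes u v :: "'a::real_normed_vector"
  shows "norm (midpoint u v - midpoint u' v') \<le> norm (u - u') + norm (v - v')"
proof -
  have "midpoint u v - midpoint u' v' = (1 / 2) *\<^sub>R ((u - u') + (v - v'))"
    by (simp add: midpoint_def algebra_simps)
  then have "norm (midpoint u v - midpoint u' v') = norm ((u - u') + (v - v')) / 2"
    by simp
  also have "\<dots> \<le> norm (u - u') + norm (v - v')"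
    using norm_triangle_ineq[of "u - u'" "v - v'"] norm_ge_zero[of "(u - u') + (v - v')"] by linarith
  finally show ?thesis .
qed

lemma vector_derivative_bound_imp_lipschitz:
  fixes p :: "real \<Rightarrow> 'a::real_normed_vector"
  assumes "\<And>t. t \<in> {a..b} \<Longrightarrow> (p has_vector_derivative p' t) (at t within {a..b})"
    and "\<And>t. t \<in> {a..b} \<Longrightarrow> norm (p' t) \<le> B" and "s \<in> {a..b}" and "t \<in> {a..b}"
  shows "norm (p s - p t) \<le> B * \<bar>s - t\<bar>"
proof -
  have "norm (p s - p t) \<le> B * norm (s - t)"
  proof (rule differentiable_bound[where S = "{a..b}"])
    show "(p has_derivative (\<lambda>h. h *\<^sub>R p' x)) (at x within {a..b})" if "x \<in> {a..b}" for x
      using assms(1)[OF that] by (simp add: has_vector_derivative_def)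
    show "onorm (\<lambda>h. h *\<^sub>R p' x) \<le> B" if "x \<in> {a..b}" for x
    proof (rule onorm_le)
      fix s :: real
      show "norm (s *\<^sub>R p' x) \<le> B * norm s"
        using mult_left_mono[OF assms(2)[OF that], of "\<bar>s\<bar>"] by (simp add: mult.commute)
    qed
  qed (use assms in auto)
  then show ?thesis
    by simp
qed

text \<open>The symmetric sum \<open>p (m + t) + p (m - t)\<close> has derivative
  \<open>p' (m + t) - p' (m - t)\<close>, which the Lipschitz condition already makes of order
  \<open>t\<close>. Thus no second derivative of \<open>p\<close> enters.\<close>

lemma second_difference_bound:
  fixes p :: "real \<Rightarrow> 'a::real_normed_vector"
  assumes p: "\<And>t. t \<in> {0..2 * m} \<Longrightarrow> (p has_vector_derivative p' t) (at t within {0..2 * m})"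
    and lip: "\<And>s t. s \<in> {0..2 * m} \<Longrightarrow> t \<in> {0..2 * m} \<Longrightarrow> norm (p' s - p' t) \<le> C * \<bar>s - t\<bar>"
    and "0 \<le> C" and "r \<in> {0..m}"
  shows "norm (p (m + r) + p (m - r) - 2 *\<^sub>R p m) \<le> 2 * C * m ^ 2"
proof -
  define g where "g t = p (m + t) + p (m - t)" for t
  have "norm (g r - g 0) \<le> (2 * C * m) * \<bar>r - 0\<bar>"
  proof (rule vector_derivative_bound_imp_lipschitz[where a = 0 and b = m])
    fix t assume t: "t \<in> {0..m}"
    have "((\<lambda>t. p (m + t)) has_vector_derivative 1 *\<^sub>R p' (m + t)) (at t within {0..m})"
    proof (rule vector_diff_chain_within[of "\<lambda>t. m + t" 1 t "{0..m}" p, unfolded o_def])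
      show "(p has_vector_derivative p' (m + t)) (at (m + t) within (+) m ` {0..m})"
        by (rule has_vector_derivative_within_subset[OF p]) (use t in auto)
    qed (auto intro!: derivative_eq_intros)
    moreover have "((\<lambda>t. p (m - t)) has_vector_derivative (- 1) *\<^sub>R p' (m - t)) (at t within {0..m})"
    proof (rule vector_diff_chain_within[of "\<lambda>t. m - t" "-1" t "{0..m}" p, unfolded o_def])
      show "(p has_vector_derivative p' (m - t)) (at (m - t) within (-) m ` {0..m})"
        by (rule has_vector_derivative_within_subset[OF p]) (use t in auto)
    qed (auto intro!: derivative_eq_intros)
    ultimately show "(g has_vector_derivative p' (m + t) - p' (m - t)) (at t within {0..m})"
      unfolding g_def using has_vector_derivative_add by fastforce
    have "norm (p' (m + t) - p' (m - t)) \<le> C * (2 * t)"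
      using lip[of "m + t" "m - t"] t by simp
    also have "\<dots> \<le> 2 * C * m"
      using t \<open>0 \<le> C\<close> by (simp add: mult_left_mono)
    finally show "norm (p' (m + t) - p' (m - t)) \<le> 2 * C * m" .
  qed (use assms in auto)
  also have "\<dots> \<le> (2 * C * m) * m"
    using assms by (intro mult_left_mono) auto
  finally show ?thesis
    by (simp add: g_def power2_eq_square scaleR_2 algebra_simps)
qed

text \<open>First exit time: \<open>F\<close> is bounded only inside the ball, so the bound is
  applied before the least time \<open>s\<close> at which the distance reaches
  \<open>\<delta>\<close>. Up to then the path has length at most \<open>B * s\<close>, which is too
  short. Compactness of \<open>E\<close> provides the least time.\<close>

lemma trajectory_stays_in_cball:
  fixes F :: "'a::real_normed_vector \<Rightarrow> 'a"
  assumes w: "trajectory F S {0..h} w" and B: "\<And>z. z \<in> cball (w 0) \<delta> \<Longrightarrow> norm (F z) \<le> B"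
    and "0 < \<delta>" and "0 \<le> h" and "B * h < \<delta>" and "t \<in> {0..h}"
  shows "w t \<in> cball (w 0) \<delta>"
proof (rule ccontr)
  assume "w t \<notin> cball (w 0) \<delta>"
  define N where "N s = norm (w s - w 0)" for s
  have cw: "continuous_on {0..h} w"
    using trajectory_continuous_on[OF w] .
  have cN: "continuous_on {0..t} N"
    unfolding N_def using continuous_on_subset[OF cw, of "{0..t}"] \<open>t \<in> {0..h}\<close>
    by (intro continuous_intros) auto
  define E where "E = {s \<in> {0..t}. \<delta> \<le> N s}"
  have "closed E"
    unfolding E_def by (intro continuous_on_closed_Collect_le cN continuous_on_const closed_atLeastAtMost)
  moreover have "bounded E"
    by (rule bounded_subset[of "{0..t}"]) (auto simp: E_def)
  ultimately have "compact E"
    by (simp add: compact_eq_bounded_closed)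
  moreover have "t \<in> E"
    using \<open>w t \<notin> cball (w 0) \<delta>\<close> \<open>t \<in> {0..h}\<close> by (auto simp: E_def N_def dist_norm norm_minus_commute)
  ultimately obtain s where s: "s \<in> E" "\<And>r. r \<in> E \<Longrightarrow> s \<le> r"
    using compact_attains_inf[of E] by (metis empty_iff)
  have st: "0 \<le> s" "s \<le> t" "\<delta> \<le> N s"
    using s(1) by (auto simp: E_def)
  have "0 < s"
    using st \<open>0 < \<delta>\<close> by (cases "s = 0") (auto simp: N_def)
  have "norm (w s - w 0) \<le> B * s - B * 0"
  proof (rule differentiable_bound_general[where f' = "\<lambda>r. F (w r)" and \<phi>' = "\<lambda>r. B" and \<phi> = "\<lambda>r. B * r"])
    show "continuous_on {0..s} w"
      using continuous_on_subset[OF cw] st \<open>t \<in> {0..h}\<close> by auto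
    fix r assume r: "0 < r" "r < s"
    then have "r \<in> interior {0..h}" "r \<in> {0..h}"
      using st \<open>t \<in> {0..h}\<close> by auto
    then show "(w has_vector_derivative F (w r)) (at r)"
      using w at_within_interior[of r "{0..h}"] unfolding trajectory_def by metis
    have "r \<notin> E"
      using s(2) r by force
    then show "norm (F (w r)) \<le> B"
      using r st by (intro B) (auto simp: E_def N_def dist_norm norm_minus_commute)
  qed (use \<open>0 < s\<close> in \<open>auto intro!: continuous_intros derivative_eq_intros\<close>)
  moreover have "0 \<le> B"
    using B[of "w 0"] \<open>0 < \<delta>\<close> norm_ge_zero[of "F (w 0)"] by (meson centre_in_cball less_imp_le order_trans)
  then have "B * s \<le> B * h"
    using st \<open>t \<in> {0..h}\<close> by (intro mult_left_mono) auto
  ultimately show False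
    using st(3) \<open>B * h < \<delta>\<close> by (simp add: N_def)
qed

text \<open>
  With \<open>m = h / 2\<close> the defect splits into the error of the midpoint quadrature rule for
  \<open>t \<mapsto> F (w t)\<close> and \<open>h\<close> times \<open>F (w m) - F (midpoint (w 0) (w h))\<close>; both are second
  differences in disguise.
\<close>

lemma midpoint_defect:
  fixes F :: "'a::real_normed_vector \<Rightarrow> 'a"
  assumes w: "trajectory F S {0..h} w" and wA: "\<And>t. t \<in> {0..h} \<Longrightarrow> w t \<in> A" and "convex A"
    and B: "\<And>z. z \<in> A \<Longrightarrow> norm (F z) \<le> B" and L: "L-lipschitz_on A F"
    and F': "\<And>z. z \<in> A \<Longrightarrow> (F has_derivative F' z) (at z)"
    and L': "L'-lipschitz_on A (\<lambda>z. F' z (F z))"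
    and "0 \<le> h" and "0 \<le> B"
  shows "norm (w h - w 0 - h *\<^sub>R F (midpoint (w 0) (w h))) \<le> (L' + L * L) * B * h ^ 3"
proof -
  define m where "m = h / 2"
  have h: "h = 2 * m" and m: "0 \<le> m"
    using \<open>0 \<le> h\<close> by (auto simp: m_def)
  have L0: "0 \<le> L" "0 \<le> L'"
    using L L' lipschitz_on_nonneg by auto
  define g where "g t = F (w t)" for t
  define g' where "g' t = F' (w t) (F (w t))" for t
  have w': "(w has_vector_derivative g t) (at t within {0..2 * m})" if "t \<in> {0..2 * m}" for t
    using w that by (simp add: trajectory_def h g_def)
  have wl: "norm (w s - w t) \<le> B * \<bar>s - t\<bar>" if "s \<in> {0..2 * m}" "t \<in> {0..2 * m}" for s t
    using vector_derivative_bound_imp_lipschitz[OF w' _ that] B wA by (simp add: g_def h)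
  have comp: "norm (f (w s) - f (w t)) \<le> l * B * \<bar>s - t\<bar>"
    if "l-lipschitz_on A f" "s \<in> {0..2 * m}" "t \<in> {0..2 * m}" for l and f :: "'a \<Rightarrow> 'a" and s t
  proof -
    have "norm (f (w s) - f (w t)) \<le> l * norm (w s - w t)"
      using lipschitz_onD[OF that(1)] wA that by (simp add: dist_norm h)
    also have "\<dots> \<le> l * (B * \<bar>s - t\<bar>)"
      using wl that lipschitz_on_nonneg[OF that(1)] by (intro mult_left_mono) auto
    finally show ?thesis
      by (simp add: mult.assoc)
  qed
  have g'': "(g has_vector_derivative g' t) (at t within {0..2 * m})" if "t \<in> {0..2 * m}" for t
    unfolding g_def g'_def
    using vector_derivative_diff_chain_within[OF w'[OF that] has_derivative_at_withinI[OF F']] wA that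
    by (simp add: o_def g_def h)
  have "norm (w (m + m) + w (m - m) - 2 *\<^sub>R w m) \<le> 2 * (L * B) * m ^ 2"
    using second_difference_bound[OF w', of "L * B" m] comp[OF L] L0 \<open>0 \<le> B\<close> m
    by (simp add: g_def)
  moreover have "midpoint (w 0) (w h) - w m = (1 / 2) *\<^sub>R (w (m + m) + w (m - m) - 2 *\<^sub>R w m)"
    by (simp add: midpoint_def h algebra_simps)
  ultimately have mid: "norm (midpoint (w 0) (w h) - w m) \<le> L * B * m ^ 2"
    by simp
  \<comment> \<open>\<open>\<psi> t\<close> is the error of the midpoint quadrature rule for
    \<open>g\<close> on the interval from \<open>m - t\<close> to \<open>m + t\<close>; its
    derivative is a second difference of \<open>g\<close>.\<close>
  define \<psi> where "\<psi> t = w (m + t) - w (m - t) - (2 * t) *\<^sub>R g m" for t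
  have "norm (\<psi> m - \<psi> 0) \<le> (2 * (L' * B) * m ^ 2) * \<bar>m - 0\<bar>"
  proof (rule vector_derivative_bound_imp_lipschitz[where a = 0 and b = m])
    fix t assume t: "t \<in> {0..m}"
    have "((\<lambda>t. w (m + t)) has_vector_derivative 1 *\<^sub>R g (m + t)) (at t within {0..m})"
    proof (rule vector_diff_chain_within[of "\<lambda>t. m + t" 1 t "{0..m}" w, unfolded o_def])
      show "(w has_vector_derivative g (m + t)) (at (m + t) within (+) m ` {0..m})"
        by (rule has_vector_derivative_within_subset[OF w']) (use t in auto)
    qed (auto intro!: derivative_eq_intros)
    moreover have "((\<lambda>t. w (m - t)) has_vector_derivative (- 1) *\<^sub>R g (m - t)) (at t within {0..m})"
    proof (rule vector_diff_chain_within[of "\<lambda>t. m - t" "-1" t "{0..m}" w, unfolded o_def])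
      show "(w has_vector_derivative g (m - t)) (at (m - t) within (-) m ` {0..m})"
        by (rule has_vector_derivative_within_subset[OF w']) (use t in auto)
    qed (auto intro!: derivative_eq_intros)
    moreover have "((\<lambda>t. (2 * t) *\<^sub>R g m) has_vector_derivative 2 *\<^sub>R g m) (at t within {0..m})"
      by (auto intro!: derivative_eq_intros)
    ultimately have "(\<psi> has_vector_derivative 1 *\<^sub>R g (m + t) - (- 1) *\<^sub>R g (m - t) - 2 *\<^sub>R g m)
        (at t within {0..m})"
      unfolding \<psi>_def by (intro has_vector_derivative_diff)
    then show "(\<psi> has_vector_derivative g (m + t) + g (m - t) - 2 *\<^sub>R g m) (at t within {0..m})"
      by simp
    show "norm (g (m + t) + g (m - t) - 2 *\<^sub>R g m) \<le> 2 * (L' * B) * m ^ 2"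
      using second_difference_bound[OF g'' _ _ t, where C = "L' * B"] comp[OF L'] L0 \<open>0 \<le> B\<close>
      by (simp add: g'_def)
  qed (use m in auto)
  moreover have "\<psi> m - \<psi> 0 = w h - w 0 - h *\<^sub>R F (w m)"
    unfolding \<psi>_def g_def h mult_2 by simp
  moreover have "(2 * (L' * B) * m ^ 2) * \<bar>m - 0\<bar> = 2 * (L' * B) * m ^ 3"
    using m by (simp add: power3_eq_cube power2_eq_square)
  ultimately have quad: "norm (w h - w 0 - h *\<^sub>R F (w m)) \<le> 2 * (L' * B) * m ^ 3"
    by (simp only:)
  have "midpoint (w 0) (w h) \<in> A"
    using \<open>convex A\<close> wA[of 0] wA[of h] \<open>0 \<le> h\<close> by (simp add: midpoint_in_convex)
  then have "norm (F (w m) - F (midpoint (w 0) (w h))) \<le> L * norm (w m - midpoint (w 0) (w h))"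
    using lipschitz_onD[OF L wA] m by (simp add: dist_norm h)
  also have "\<dots> \<le> L * (L * B * m ^ 2)"
    using mid L0 by (intro mult_left_mono) (simp_all add: norm_minus_commute)
  finally have "h * norm (F (w m) - F (midpoint (w 0) (w h))) \<le> h * (L * (L * B * m ^ 2))"
    using \<open>0 \<le> h\<close> by (rule mult_left_mono)
  then have snd: "norm (h *\<^sub>R (F (w m) - F (midpoint (w 0) (w h)))) \<le> 2 * (L * L * B) * m ^ 3"
    using \<open>0 \<le> h\<close> by (simp add: h power3_eq_cube power2_eq_square mult_ac)
  have "w h - w 0 - h *\<^sub>R F (midpoint (w 0) (w h)) =
      (w h - w 0 - h *\<^sub>R F (w m)) + h *\<^sub>R (F (w m) - F (midpoint (w 0) (w h)))"
    by (simp add: algebra_simps)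
  then have "norm (w h - w 0 - h *\<^sub>R F (midpoint (w 0) (w h))) \<le>
      2 * (L' * B) * m ^ 3 + 2 * (L * L * B) * m ^ 3"
    by (simp only:) (rule norm_triangle_mono[OF quad snd])
  also have "\<dots> = (L' + L * L) * B * h ^ 3 / 4"
    by (simp add: h power_mult_distrib algebra_simps)
  also have "\<dots> \<le> (L' + L * L) * B * h ^ 3"
    using L0 \<open>0 \<le> B\<close> \<open>0 \<le> h\<close> by simp
  finally show ?thesis .
qed

section \<open>Order two of the implicit midpoint method\<close>

lemma midpoint_increment_bounds:
  fixes F :: "'a::euclidean_space \<Rightarrow> 'a"
  assumes "open S" and F: "Ck_on 1 S F" and "compact K" and "K \<subseteq> S"
  shows "\<exists>\<delta> B L. increment_bounds (\<lambda>u v. midpoint u v \<in> S) (\<lambda>u v. F (midpoint u v)) K \<delta> B L"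
proof -
  obtain \<delta> K' where K': "\<delta> > 0" "compact K'" "K' \<subseteq> S" "\<And>c. c \<in> K \<Longrightarrow> cball c \<delta> \<subseteq> K'"
    using compact_nbhd[OF \<open>open S\<close> assms(3,4)] by blast
  obtain L where L: "L \<ge> 0" "\<And>A. convex A \<Longrightarrow> A \<subseteq> K' \<Longrightarrow> L-lipschitz_on A F"
    using Ck_on_lipschitz[OF F K'(2,3)] by blast
  have "continuous_on K' F"
    using F Ck_on_SucD[of 0 S F] continuous_on_subset K'(3) by auto
  then obtain B where B: "B \<ge> 0" "\<And>z. z \<in> K' \<Longrightarrow> norm (F z) \<le> B"
    using continuous_on_compact_norm_bound K'(2) by blast
  have "increment_bounds (\<lambda>u v. midpoint u v \<in> S) (\<lambda>u v. F (midpoint u v)) K \<delta> B L"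
    unfolding increment_bounds_def
  proof (intro conjI ballI)
    fix c u v assume c: "c \<in> K" and uv: "u \<in> cball c \<delta>" "v \<in> cball c \<delta>"
    have mid: "midpoint u v \<in> cball c \<delta>" if "u \<in> cball c \<delta>" "v \<in> cball c \<delta>" for u v
      using midpoint_in_convex[OF convex_cball that] .
    then show "midpoint u v \<in> S" "norm (F (midpoint u v)) \<le> B"
      using K' B c uv by blast+
    fix u' v' assume uv': "u' \<in> cball c \<delta>" "v' \<in> cball c \<delta>"
    have "norm (F (midpoint u v) - F (midpoint u' v')) \<le> L * norm (midpoint u v - midpoint u' v')"
      using lipschitz_onD[OF L(2)[OF convex_cball K'(4)[OF c]] mid[OF uv] mid[OF uv']]
      by (simp add: dist_norm)
    also have "\<dots> \<le> L * (norm (u - u') + norm (v - v'))"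
      using L(1) by (intro mult_left_mono norm_midpoint_diff_le)
    finally show "norm (F (midpoint u v) - F (midpoint u' v')) \<le> L * (norm (u - u') + norm (v - v'))" .
  qed (use K' B L in auto)
  then show ?thesis
    by blast
qed

lemma midpoint_defect_bounds:
  fixes F :: "'a::euclidean_space \<Rightarrow> 'a"
  assumes "open S" and F: "Ck_on 2 S F" and "compact K" and "K \<subseteq> S"
  shows "\<exists>h1 B C. defect_bounds F S (\<lambda>u v. F (midpoint u v)) 2 K h1 B C"
proof -
  obtain \<delta> K' where K': "\<delta> > 0" "compact K'" "K' \<subseteq> S" "\<And>c. c \<in> K \<Longrightarrow> cball c \<delta> \<subseteq> K'"
    using compact_nbhd[OF \<open>open S\<close> assms(3,4)] by blast
  have F2: "Ck_on (Suc 1) S F"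
    using F by (simp add: numeral_2_eq_2 del: Ck_on.simps)
  then have F1: "Ck_on 1 S F"
    by (rule Ck_on_SucD)
  obtain L where L: "L \<ge> 0" "\<And>A. convex A \<Longrightarrow> A \<subseteq> K' \<Longrightarrow> L-lipschitz_on A F"
    using Ck_on_lipschitz[OF F1 K'(2,3)] by blast
  \<comment> \<open>Here both derivatives of \<open>F\<close> are used: the map
    \<open>z \<mapsto> F' z (F z)\<close> contains one, and its Lipschitz constant takes
    another.\<close>
  obtain L' where L': "L' \<ge> 0"
      "\<And>A. convex A \<Longrightarrow> A \<subseteq> K' \<Longrightarrow> L'-lipschitz_on A (\<lambda>z. frechet_derivative F (at z) (F z))"
    using Ck_on_lipschitz[OF Ck_on_directional_derivative[OF \<open>open S\<close> F2 F1] K'(2,3)] by blast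
  have "continuous_on K' F"
    using F1 Ck_on_SucD[of 0 S F] continuous_on_subset K'(3) by auto
  then obtain B where B: "B \<ge> 0" "\<And>z. z \<in> K' \<Longrightarrow> norm (F z) \<le> B"
    using continuous_on_compact_norm_bound K'(2) by blast
  have "norm (w h - w 0) \<le> B * h \<and>
      norm (w h - w 0 - h *\<^sub>R F (midpoint (w 0) (w h))) \<le> ((L' + L * L) * B) * h ^ (2 + 1)"
    if "0 < h \<and> h \<le> \<delta> / (2 * (B + 1)) \<and> w 0 \<in> K \<and> trajectory F S {0..h} w" for h w
  proof -
    have w: "trajectory F S {0..h} w" and "0 < h" "w 0 \<in> K"
      using that by auto
    have "B * h < \<delta>"
      using that B(1) K'(1) by (auto simp: field_simps)
    have sub: "cball (w 0) \<delta> \<subseteq> K'"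
      using K'(4) \<open>w 0 \<in> K\<close> .
    have wA: "w t \<in> cball (w 0) \<delta>" if "t \<in> {0..h}" for t
      by (rule trajectory_stays_in_cball[OF w _ K'(1) _ \<open>B * h < \<delta>\<close> that])
         (use B(2) sub \<open>0 < h\<close> in auto)
    have "norm (w h - w 0) \<le> B * \<bar>h - 0\<bar>"
    proof (rule vector_derivative_bound_imp_lipschitz[where a = 0 and b = h and p' = "\<lambda>t. F (w t)"])
      show "norm (F (w t)) \<le> B" if "t \<in> {0..h}" for t
        using wA[OF that] B(2) sub by blast
    qed (use w \<open>0 < h\<close> in \<open>auto simp: trajectory_def\<close>)
    moreover have "norm (w h - w 0 - h *\<^sub>R F (midpoint (w 0) (w h))) \<le> (L' + L * L) * B * h ^ 3"
    proof (rule midpoint_defect[OF w wA convex_cball])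
      show "L-lipschitz_on (cball (w 0) \<delta>) F"
        using L(2) sub by simp
      show "L'-lipschitz_on (cball (w 0) \<delta>) (\<lambda>z. frechet_derivative F (at z) (F z))"
        using L'(2) sub by simp
      show "(F has_derivative frechet_derivative F (at z)) (at z)" if "z \<in> cball (w 0) \<delta>" for z
        using Ck_on_has_derivative[OF F2] that sub K'(3) by blast
    qed (use B sub \<open>0 < h\<close> in auto)
    ultimately show ?thesis
      using \<open>0 < h\<close> by (simp add: numeral_3_eq_3 numeral_2_eq_2)
  qed
  then have "defect_bounds F S (\<lambda>u v. F (midpoint u v)) 2 K (\<delta> / (2 * (B + 1))) B ((L' + L * L) * B)"
    unfolding defect_bounds_def using K'(1) B(1) L(1) L'(1) by auto
  then show ?thesis
    by blast
qed

lemma implicit_midpoint_has_order: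
  fixes F :: "'a::euclidean_space \<Rightarrow> 'a"
  assumes "open S" and F: "Ck_on 2 S F"
  shows "has_order F S (implicit_midpoint F S) 2"
proof -
  have F1: "Ck_on 1 S F"
    using F Ck_on_SucD[of 1 S F] by (simp add: numeral_2_eq_2 del: Ck_on.simps)
  have step: "implicit_midpoint F S h u v \<longleftrightarrow>
      midpoint u v \<in> S \<and> v = u + h *\<^sub>R F (midpoint u v)" for h u v
    by (simp add: implicit_midpoint_def)
  show ?thesis
    unfolding has_order_def
    using local_error_orderI[OF step midpoint_increment_bounds[OF \<open>open S\<close> F1]
        midpoint_defect_bounds[OF \<open>open S\<close> F]]
      global_error_orderI[OF step midpoint_increment_bounds[OF \<open>open S\<close> F1]
        midpoint_defect_bounds[OF \<open>open S\<close> F]]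
    by simp
qed

section \<open>Quadratic invariants\<close>

text \<open>Composing \<open>F\<close> with the nearest-point projection onto the ball gives a
  globally bounded and Lipschitz field, so the Picard operator acts on the whole Banach space of
  bounded continuous functions. The fixed point moves by at most
  \<open>B * \<epsilon> \<le> \<delta>\<close>, hence never leaves the ball, and the projection
  disappears from its equation.\<close>

lemma local_trajectory_exists:
  fixes F :: "'a::euclidean_space \<Rightarrow> 'a"
  assumes "\<delta> > 0" and B: "\<And>x. x \<in> cball z \<delta> \<Longrightarrow> norm (F x) \<le> B" and L: "L-lipschitz_on (cball z \<delta>) F"
  obtains \<epsilon> w where "\<epsilon> > 0" and "w 0 = z" and "trajectory F (cball z \<delta>) {0..\<epsilon>} w"
proof -
  define P where "P = closest_point (cball z \<delta>)"
  have P: "P x \<in> cball z \<delta>" for x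
    unfolding P_def using \<open>\<delta> > 0\<close> by (intro closest_point_in_set) auto
  have P_self: "P x = x" if "x \<in> cball z \<delta>" for x
    unfolding P_def using that by (rule closest_point_self)
  have P_lip: "dist (P x) (P y) \<le> dist x y" for x y
    unfolding P_def using \<open>\<delta> > 0\<close> by (intro closest_point_lipschitz) auto
  have L0: "0 \<le> L" and B0: "0 \<le> B"
    using lipschitz_on_nonneg[OF L] B[of z] \<open>\<delta> > 0\<close> order_trans[OF norm_ge_zero] by auto
  define \<epsilon> where "\<epsilon> = min (\<delta> / (B + 1)) (1 / (2 * (L + 1)))"
  have \<epsilon>: "0 < \<epsilon>" "B * \<epsilon> \<le> \<delta>" "L * \<epsilon> \<le> 1 / 2"
  proof -
    show "0 < \<epsilon>"
      using \<open>\<delta> > 0\<close> L0 B0 by (simp add: \<epsilon>_def)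
    have "\<epsilon> \<le> \<delta> / (B + 1)" "\<epsilon> \<le> 1 / (2 * (L + 1))"
      by (simp_all add: \<epsilon>_def)
    then show "B * \<epsilon> \<le> \<delta>" "L * \<epsilon> \<le> 1 / 2"
      using L0 B0 \<open>0 < \<epsilon>\<close> by (simp_all add: field_simps)
  qed
  define F' where "F' x = F (P x)" for x
  have F'_lip: "norm (F' x - F' y) \<le> L * dist x y" for x y
    using lipschitz_onD[OF L P P, of x y] mult_left_mono[OF P_lip[of x y] L0]
    by (simp add: F'_def dist_norm)
  have F'_B: "norm (F' x) \<le> B" for x
    using B[OF P] by (simp add: F'_def)
  have cF': "continuous_on UNIV F'"
    using F'_lip L0 by (intro lipschitz_on_continuous_on[of L] lipschitz_onI) (auto simp: dist_norm)
  \<comment> \<open>Clamping time to \<open>{0..\<epsilon>}\<close> extends the integral operator to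
    functions on the whole real line, as the type of bounded continuous functions requires.\<close>
  define cl where "cl t = max 0 (min \<epsilon> t)" for t
  have cl: "cl t \<in> {0..\<epsilon>}" for t
    using \<epsilon>(1) by (auto simp: cl_def)
  define I where "I w t = z + integral {0..cl t} (\<lambda>s. F' (w s))" for w t
  have cw: "continuous_on A (\<lambda>s. F' (apply_bcontfun w s))" for A and w :: "real \<Rightarrow>\<^sub>C 'a"
    by (rule continuous_on_compose2[OF cF']) auto
  have small: "norm (integral {0..cl t} (\<lambda>s. F' (apply_bcontfun w s))) \<le> \<delta>" for w t
  proof -
    have "norm (integral {0..cl t} (\<lambda>s. F' (apply_bcontfun w s))) \<le> B * (cl t - 0)"
      using cl[of t] by (intro integral_bound cw) (auto simp: F'_B)
    also have "\<dots> \<le> B * \<epsilon>"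
      using cl[of t] B0 by (intro mult_left_mono) auto
    finally show ?thesis
      using \<epsilon>(2) by linarith
  qed
  have I: "I (apply_bcontfun w) \<in> bcontfun" for w
  proof (rule bcontfun_normI)
    have "continuous_on {0..\<epsilon>} (\<lambda>t. integral {0..t} (\<lambda>s. F' (apply_bcontfun w s)))"
      by (intro indefinite_integral_continuous_1 integrable_continuous_real cw)
    then have "continuous_on UNIV (\<lambda>t. integral {0..cl t} (\<lambda>s. F' (apply_bcontfun w s)))"
      by (rule continuous_on_compose2) (use cl in \<open>auto simp: cl_def intro!: continuous_intros\<close>)
    then show "continuous_on UNIV (I (apply_bcontfun w))"
      unfolding I_def by (intro continuous_intros)
    show "norm (I (apply_bcontfun w) t) \<le> norm z + \<delta>" for t
      unfolding I_def using small by (rule norm_triangle_mono[OF order_refl])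
  qed
  define T where "T w = Bcontfun (I (apply_bcontfun w))" for w
  have T: "apply_bcontfun (T w) t = I (apply_bcontfun w) t" for w t
    unfolding T_def using Bcontfun_inverse[OF I] by simp
  have "\<exists>!w. T w = w"
  proof (rule banach_fix_type[of "1 / 2"])
    show "\<forall>w v. dist (T w) (T v) \<le> 1 / 2 * dist w v"
    proof (intro allI dist_bound)
      fix w v :: "real \<Rightarrow>\<^sub>C 'a" and t
      have "norm (F' (apply_bcontfun w s) - F' (apply_bcontfun v s)) \<le> L * dist w v" for s
        using F'_lip mult_left_mono[OF dist_bounded[of w s v] L0] by (rule order_trans)
      then have "norm (integral {0..cl t} (\<lambda>s. F' (apply_bcontfun w s) - F' (apply_bcontfun v s)))
          \<le> L * dist w v * (cl t - 0)"
        using cl[of t] by (intro integral_bound continuous_on_diff cw) auto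
      also have "\<dots> \<le> L * dist w v * \<epsilon>"
        using cl[of t] L0 by (intro mult_left_mono) auto
      also have "\<dots> \<le> 1 / 2 * dist w v"
        using mult_right_mono[OF \<epsilon>(3), of "dist w v"] by (simp add: mult_ac)
      finally show "dist (apply_bcontfun (T w) t) (apply_bcontfun (T v) t) \<le> 1 / 2 * dist w v"
        by (simp add: T I_def dist_norm integral_diff integrable_continuous_real cw)
    qed
  qed auto
  then obtain W where "T W = W"
    by blast
  define w where "w = apply_bcontfun W"
  have w: "w t = z + integral {0..t} (\<lambda>s. F' (w s))" if "t \<in> {0..\<epsilon>}" for t
    using T[of W t] that by (simp add: \<open>T W = W\<close> w_def I_def cl_def)
  have in_cball: "w t \<in> cball z \<delta>" for t
    using T[of W t] small[of t W] by (simp add: \<open>T W = W\<close> w_def I_def dist_norm)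
  show ?thesis
  proof (rule that[of \<epsilon> w])
    show "w 0 = z"
      using w[of 0] \<epsilon>(1) by simp
    have "(w has_vector_derivative F (w t)) (at t within {0..\<epsilon>})" if t: "t \<in> {0..\<epsilon>}" for t
    proof (rule has_vector_derivative_transform[OF t])
      show "w s = z + integral {0..s} (\<lambda>s. F' (w s))" if "s \<in> {0..\<epsilon>}" for s
        using w that .
      have "((\<lambda>s. integral {0..s} (\<lambda>s. F' (w s))) has_vector_derivative F' (w t)) (at t within {0..\<epsilon>})"
        unfolding w_def using integral_has_vector_derivative[OF cw t] .
      then have "((\<lambda>s. z + integral {0..s} (\<lambda>s. F' (w s))) has_vector_derivative 0 + F' (w t))
          (at t within {0..\<epsilon>})"
        by (intro has_vector_derivative_add has_vector_derivative_const)
      then show "((\<lambda>s. z + integral {0..s} (\<lambda>s. F' (w s))) has_vector_derivative F (w t))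
          (at t within {0..\<epsilon>})"
        using P_self[OF in_cball] by (simp add: F'_def)
    qed
    then show "trajectory F (cball z \<delta>) {0..\<epsilon>} w"
      using in_cball by (simp add: trajectory_def is_interval_cc)
  qed (use \<epsilon> in auto)
qed

text \<open>In the derivative at the midpoint the cross terms \<open>b u v\<close> and
  \<open>b v u\<close> cancel, also when \<open>b\<close> is not symmetric.\<close>

lemma quadratic_function_midpoint_derivative:
  fixes q :: "'a::euclidean_space \<Rightarrow> real"
  assumes "quadratic_function q"
  obtains d where "\<And>z. (q has_derivative d z) (at z)" and "\<And>z. linear (d z)"
    and "\<And>u v. q v - q u = d (midpoint u v) (v - u)"
proof -
  obtain b l c where b: "bilinear b" and l: "linear l" and q: "q = (\<lambda>z. b z z + l z + c)"
    using assms unfolding quadratic_function_def by blast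
  have bb: "bounded_bilinear b"
    using b by (simp add: bilinear_conv_bounded_bilinear)
  interpret b: bounded_bilinear b
    by (rule bb)
  have bl: "bounded_linear l"
    using l by (simp add: linear_conv_bounded_linear)
  interpret l: bounded_linear l
    by (rule bl)
  define d where "d z v = b z v + b v z + l v" for z v
  have der: "(q has_derivative d z) (at z)" for z
    unfolding q d_def
    by (auto intro!: derivative_eq_intros bounded_bilinear.FDERIV[OF bb] bounded_linear.has_derivative[OF bl])
  show ?thesis
  proof (rule that[of d])
    show "linear (d z)" for z
      using der has_derivative_linear by blast
    show "q v - q u = d (midpoint u v) (v - u)" for u v
      by (simp add: q d_def midpoint_def b.add_left b.add_right b.diff_left b.diff_right
          b.scaleR_left b.scaleR_right l.diff algebra_simps)
  qed (rule der)
qed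

lemma quadratic_invariant_implicit_midpoint:
  fixes F :: "'a::euclidean_space \<Rightarrow> 'a"
  assumes "open S" and F: "Ck_on 1 S F" and q: "quadratic_invariant F S q"
    and step: "implicit_midpoint F S h u v"
  shows "q v = q u"
proof -
  define z where "z = midpoint u v"
  have z: "z \<in> S" and v: "v - u = h *\<^sub>R F z"
    using step by (auto simp: implicit_midpoint_def z_def algebra_simps)
  obtain d where d: "\<And>z. (q has_derivative d z) (at z)" "\<And>z. linear (d z)"
      "\<And>u v. q v - q u = d (midpoint u v) (v - u)"
    using quadratic_function_midpoint_derivative q unfolding quadratic_invariant_def by blast
  obtain \<delta> K where K: "\<delta> > 0" "compact K" "K \<subseteq> S" "cball z \<delta> \<subseteq> K"
    using compact_nbhd[OF \<open>open S\<close>, of "{z}"] z by auto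
  obtain L where L: "L-lipschitz_on (cball z \<delta>) F"
    using Ck_on_lipschitz[OF F K(2,3)] K(4) convex_cball by metis
  have "continuous_on K F"
    using F Ck_on_SucD[of 0 S F] continuous_on_subset K(3) by auto
  then obtain B where B: "\<And>x. x \<in> K \<Longrightarrow> norm (F x) \<le> B"
    using continuous_on_compact_norm_bound K(2) by blast
  obtain \<epsilon> w where w: "\<epsilon> > 0" "w 0 = z" "trajectory F (cball z \<delta>) {0..\<epsilon>} w"
    using local_trajectory_exists[OF K(1) _ L] B K(4) by blast
  have "trajectory F S {0..\<epsilon>} w"
    using w(3) K unfolding trajectory_def by blast
  then have "(\<lambda>t. q (w t)) constant_on {0..\<epsilon>}"
    using q unfolding quadratic_invariant_def by blast
  then obtain c where c: "\<And>t. t \<in> {0..\<epsilon>} \<Longrightarrow> q (w t) = c"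
    unfolding constant_on_def by blast
  have 0: "0 \<in> {0..\<epsilon>}"
    using w(1) by simp
  \<comment> \<open>The trajectory only runs forward from \<open>z\<close>, so both derivatives are
    one-sided; they agree because the interval is nondegenerate.\<close>
  have "((\<lambda>t. q (w t)) has_vector_derivative d z (F z)) (at 0 within {0..\<epsilon>})"
    using vector_derivative_diff_chain_within[OF _ has_derivative_at_withinI[OF d(1)], of w "F z" 0 "{0..\<epsilon>}" ]
      w(2,3) 0 by (auto simp: trajectory_def o_def)
  moreover have "((\<lambda>t. q (w t)) has_vector_derivative 0) (at 0 within {0..\<epsilon>})"
    by (rule has_vector_derivative_transform[OF 0 c has_vector_derivative_const])
  ultimately have "d z (F z) = 0"
    using vector_derivative_unique_within[of 0 "{0..\<epsilon>}"] w(1)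
    by (metis at_within_Icc_at_right trivial_limit_at_right_real)
  then show ?thesis
    using d(3)[of v u] linear_scale[OF d(2)] by (simp add: v flip: z_def)
qed

section \<open>The Jacobian of the constraint and the extended field\<close>

lemma sum_UNIV_Plus:
  fixes f :: "'a::finite + 'b::finite \<Rightarrow> 'c::comm_monoid_add"
  shows "(\<Sum>k\<in>UNIV. f k) = (\<Sum>i\<in>UNIV. f (Inl i)) + (\<Sum>j\<in>UNIV. f (Inr j))"
  by (simp add: sum.Plus flip: UNIV_Plus_UNIV)

lemma inner_stack: "stack z \<bullet> v = (\<Sum>i\<in>UNIV. fst z $ i * v $ Inl i) + (\<Sum>j\<in>UNIV. snd z $ j * v $ Inr j)"
  by (simp add: inner_vec_def sum_UNIV_Plus stack_def)

lemma linear_stack: "linear stack"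
  by (auto simp: linear_iff stack_def vec_eq_iff split: sum.split)

text \<open>This is \<open>DG\<close> at \<open>z\<close> applied to \<open>v\<close>. For symmetric
  \<open>Q i\<close> it is at the same time the symmetric bilinear form belonging to the quadratic
  map, so one object serves for differentiation and for polarisation.\<close>

definition jacobian_action ::
  "('d \<Rightarrow> real^('n::finite + 'd)^('n + 'd)) \<Rightarrow> (real^'n) \<times> (real^'d::finite) \<Rightarrow>
   (real^'n) \<times> (real^'d) \<Rightarrow> real^'d" where
  "jacobian_action Q z v = jacobian_x Q z *v fst v + jacobian_y Q z *v snd v"

context
  fixes Q :: "'d::finite \<Rightarrow> real^('n::finite + 'd)^('n + 'd)"
  assumes sym: "\<And>i. transpose (Q i) = Q i"
begin

lemma symmetric_entry: "Q i $ k $ l = Q i $ l $ k"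
  using arg_cong[OF sym[of i], of "\<lambda>A. A $ l $ k"] by (simp add: transpose_def)

text \<open>The block formula for row \<open>i\<close> of \<open>N\<close> is the \<open>Inl\<close>
  part of the row vector of \<open>z\<close> times \<open>Q i\<close>; symmetry turns it into
  \<open>Q i\<close> applied to \<open>z\<close>.\<close>

lemma jacobian_x_entry: "jacobian_x Q z $ i $ j = (Q i *v stack z) $ Inl j"
  by (cases z) (simp add: jacobian_x_def vector_matrix_mult_def matrix_vector_mult_def
      sum_UNIV_Plus stack_def block11_def block12_def transpose_def symmetric_entry[of i "Inl j"] mult.commute)

lemma jacobian_y_entry: "jacobian_y Q z $ i $ j = (Q i *v stack z) $ Inr j"
  by (cases z) (simp add: jacobian_y_def vector_matrix_mult_def matrix_vector_mult_def
      sum_UNIV_Plus stack_def block12_def block22_def symmetric_entry[of i "Inr j"] mult.commute)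

lemma jacobian_action_component: "jacobian_action Q z v $ i = stack v \<bullet> (Q i *v stack z)"
  by (simp add: jacobian_action_def inner_stack matrix_vector_mult_def[of "jacobian_x Q z"]
      matrix_vector_mult_def[of "jacobian_y Q z"] jacobian_x_entry jacobian_y_entry mult.commute)

lemma jacobian_action_commute: "jacobian_action Q z v = jacobian_action Q v z"
proof -
  have "stack v \<bullet> (Q i *v stack z) = stack z \<bullet> (Q i *v stack v)" for i
    using dot_lmul_matrix[of "stack v" "Q i" "stack z"] sym[of i]
    by (metis inner_commute vector_transpose_matrix)
  then show ?thesis
    by (simp add: vec_eq_iff jacobian_action_component)
qed

lemma bounded_bilinear_jacobian_action: "bounded_bilinear (jacobian_action Q)"
proof -
  have "linear (jacobian_action Q z)" for z
    by (rule linearI) (simp_all add: vec_eq_iff jacobian_action_component linear_add[OF linear_stack]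
        linear_scale[OF linear_stack] inner_add_left)
  moreover from this have "linear (\<lambda>z. jacobian_action Q z v)" for v
    by (subst jacobian_action_commute)
  ultimately show ?thesis
    by (simp add: bilinear_def flip: bilinear_conv_bounded_bilinear)
qed

lemma quadratic_forms_jacobian: "quadratic_forms Q z = (1 / 2) *\<^sub>R jacobian_action Q z z"
  by (simp add: vec_eq_iff quadratic_forms_def jacobian_action_component)

text \<open>The identity \<open>v^2 - u^2 = (v + u) * (v - u)\<close> for the symmetric bilinear
  form \<open>jacobian_action Q\<close>; the factor 1/2 of the quadratic forms turns
  \<open>v + u\<close> into the midpoint.\<close>

lemma quadratic_forms_diff:
  "quadratic_forms Q v - quadratic_forms Q u = jacobian_action Q (midpoint u v) (v - u)"
proof -
  interpret J: bounded_bilinear "jacobian_action Q"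
    by (rule bounded_bilinear_jacobian_action)
  show ?thesis
    using jacobian_action_commute[of u v]
    by (simp add: quadratic_forms_jacobian midpoint_def J.add_left J.diff_right J.scaleR_left
        algebra_simps)
qed

lemma has_derivative_quadratic_forms:
  "(quadratic_forms Q has_derivative jacobian_action Q z) (at z)"
proof -
  have "((\<lambda>z. (1 / 2) *\<^sub>R jacobian_action Q z z) has_derivative
      (\<lambda>v. (1 / 2) *\<^sub>R (jacobian_action Q z v + jacobian_action Q v z))) (at z)"
    by (intro has_derivative_scaleR_right bounded_bilinear.FDERIV[OF bounded_bilinear_jacobian_action]
        has_derivative_ident)
  moreover have "(1 / 2) *\<^sub>R (jacobian_action Q z v + jacobian_action Q v z) = jacobian_action Q z v" for v
    by (simp add: jacobian_action_commute[of v z] flip: scaleR_2)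
  ultimately show ?thesis
    by (simp add: quadratic_forms_jacobian[abs_def])
qed

text \<open>Transfers the nonsingularity demanded by \<open>dimension_raising\<close>, which is
  phrased with a partial derivative, to the matrix \<open>M\<close>.\<close>

lemma jacobian_y_eq_partial_derivative:
  "matrix (frechet_derivative (\<lambda>v. quadratic_forms Q (x, v)) (at y)) = jacobian_y Q (x, y)"
proof -
  have "((\<lambda>v. quadratic_forms Q (x, v)) has_derivative (\<lambda>v. jacobian_action Q (x, y) (0, v))) (at y)"
    using has_derivative_compose[OF has_derivative_Pair[OF has_derivative_const has_derivative_ident]
        has_derivative_quadratic_forms] .
  then have "frechet_derivative (\<lambda>v. quadratic_forms Q (x, v)) (at y) = (\<lambda>v. jacobian_y Q (x, y) *v v)"
    using frechet_derivative_at by (fastforce simp: jacobian_action_def)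
  then show ?thesis
    by simp
qed

end

section \<open>Solving the linearised constraint for the auxiliary variables\<close>

lemma matrix_inv_mult:
  assumes "invertible A"
  shows "A ** matrix_inv A = mat 1" and "matrix_inv A ** A = mat 1"
  using someI_ex[OF assms[unfolded invertible_def]] by (simp_all add: matrix_inv_def)

text \<open>The inverse solves all four Penrose equations. Conversely the first of them, multiplied
  by the inverse from both sides, forces \<open>X\<close> to be the inverse, so the definite
  description is well defined.\<close>

lemma pseudoinverse_invertible:
  fixes A :: "real^'n^'n"
  assumes "invertible A"
  shows "pseudoinverse A = matrix_inv A"
  unfolding pseudoinverse_def
proof (rule the_equality)
  have inv: "A ** matrix_inv A = mat 1" "matrix_inv A ** A = mat 1"
    using assms by (simp_all add: matrix_inv_mult)
  then show "A ** matrix_inv A ** A = A \<and> matrix_inv A ** A ** matrix_inv A = matrix_inv A \<and>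
      transpose (A ** matrix_inv A) = A ** matrix_inv A \<and>
      transpose (matrix_inv A ** A) = matrix_inv A ** A"
    by simp
  fix X assume "A ** X ** A = A \<and> X ** A ** X = X \<and>
      transpose (A ** X) = A ** X \<and> transpose (X ** A) = X ** A"
  then have "matrix_inv A ** (A ** X ** A) ** matrix_inv A = matrix_inv A ** A ** matrix_inv A"
    by simp
  then show "X = matrix_inv A"
    using inv by (metis matrix_mul_assoc matrix_mul_lid matrix_mul_rid)
qed

text \<open>The kernel of \<open>DG\<close> is a graph over the \<open>x\<close> directions. The
  field \<open>F\<close> lies in it, the derivative of \<open>\<phi>\<close> is its slope, and the
  increment between two constraint points lies in the kernel at their midpoint.\<close>

lemma jacobian_action_eq_0_iff:
  assumes "invertible (jacobian_y Q z)"
  shows "jacobian_action Q z v = 0 \<longleftrightarrow> snd v = - ((pseudoinverse (jacobian_y Q z) ** jacobian_x Q z) *v fst v)"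
proof -
  let ?M = "jacobian_y Q z" and ?N = "jacobian_x Q z"
  have inv: "?M ** matrix_inv ?M = mat 1" "matrix_inv ?M ** ?M = mat 1"
    using assms by (simp_all add: matrix_inv_mult)
  have "jacobian_action Q z v = 0 \<longleftrightarrow> ?M *v snd v = - (?N *v fst v)"
    by (simp add: jacobian_action_def eq_neg_iff_add_eq_0 add.commute)
  also have "\<dots> \<longleftrightarrow> snd v = matrix_inv ?M *v (- (?N *v fst v))"
    using inv by (metis matrix_vector_mul_assoc matrix_vector_mul_lid)
  also have "matrix_inv ?M *v (- (?N *v fst v)) = - ((matrix_inv ?M ** ?N) *v fst v)"
    by (simp add: vec.neg matrix_vector_mul_assoc)
  finally show ?thesis
    by (simp add: pseudoinverse_invertible[OF assms])
qed

lemma jacobian_action_extended_field: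
  assumes "invertible (jacobian_y Q z)"
  shows "jacobian_action Q z (extended_field Q ft z) = 0"
  by (simp add: jacobian_action_eq_0_iff[OF assms] extended_field_def)

section \<open>Regularity of the extended field\<close>

lemma Ck_on_vec:
  fixes f :: "'a::euclidean_space \<Rightarrow> real^'n"
  assumes "open S" and "\<And>i. Ck_on k S (\<lambda>x. f x $ i)"
  shows "Ck_on k S f"
  by (rule Ck_on_componentwise[OF \<open>open S\<close>]) (auto simp: Basis_vec_def inner_axis assms(2))

lemma Ck_on_Pair:
  fixes f :: "'a::euclidean_space \<Rightarrow> 'b::real_normed_vector" and g :: "'a \<Rightarrow> 'c::real_normed_vector"
  assumes "open S" and "Ck_on k S f" and "Ck_on k S g"
  shows "Ck_on k S (\<lambda>x. (f x, g x))"
proof -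
  have l: "bounded_linear (\<lambda>u. (u, 0 :: 'c))" "bounded_linear (\<lambda>v. (0 :: 'b, v))"
    by (simp_all add: bounded_linear_Pair bounded_linear_zero bounded_linear_ident)
  from Ck_on_add[OF \<open>open S\<close> Ck_on_compose_linear[OF \<open>open S\<close> l(1) assms(2)]
      Ck_on_compose_linear[OF \<open>open S\<close> l(2) assms(3)]]
  show ?thesis
    by simp
qed

lemma Ck_on_det:
  fixes A :: "'a::euclidean_space \<Rightarrow> real^'n^'n"
  assumes "open S" and "\<And>i j. Ck_on k S (\<lambda>x. A x $ i $ j)"
  shows "Ck_on k S (\<lambda>x. det (A x))"
  unfolding det_def
  by (intro Ck_on_sum[OF \<open>open S\<close>] Ck_on_bilinear[OF \<open>open S\<close> bounded_bilinear_mult]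
      Ck_on_const[OF \<open>open S\<close>] Ck_on_prod[OF \<open>open S\<close>] assms(2))

text \<open>The pseudoinverse is given by a description and cannot be differentiated directly. By
  Cramer's rule the second component of the field is a quotient of determinants whose entries are
  C^k.\<close>

lemma Ck_on_extended_field:
  fixes Q :: "'d::finite \<Rightarrow> real^('n::finite + 'd)^('n + 'd)"
  assumes "open S" and sym: "\<And>i. transpose (Q i) = Q i"
    and inv: "\<And>z. z \<in> S \<Longrightarrow> invertible (jacobian_y Q z)" and ft: "Ck_on k S ft"
  shows "Ck_on k S (extended_field Q ft)"
proof -
  note mult = Ck_on_bilinear[OF \<open>open S\<close> bounded_bilinear_mult]
  have row: "linear (\<lambda>z. (Q i *v stack z) $ l)" for i l
    using linear_compose[OF linear_compose[OF linear_stack matrix_vector_mul_linear[of "Q i"]]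
        bounded_linear.linear[OF bounded_linear_vec_nth[of l]]]
    by (simp add: o_def)
  have N: "Ck_on k S (\<lambda>z. jacobian_x Q z $ i $ j)" and M: "Ck_on k S (\<lambda>z. jacobian_y Q z $ i $ j')" for i j j'
    unfolding jacobian_x_entry[OF sym] jacobian_y_entry[OF sym]
    by (intro Ck_on_linear[OF \<open>open S\<close>], simp add: linear_conv_bounded_linear[symmetric] row)+
  have fti: "Ck_on k S (\<lambda>z. ft z $ j)" for j
    by (rule Ck_on_compose_linear[OF \<open>open S\<close> bounded_linear_vec_nth ft])
  define b where "b z = (\<chi> i. - (\<Sum>j\<in>UNIV. jacobian_x Q z $ i $ j * ft z $ j))" for z
  have b: "Ck_on k S (\<lambda>z. b z $ i)" for i
    unfolding b_def vec_lambda_beta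
    by (intro Ck_on_compose_linear[OF \<open>open S\<close> bounded_linear_minus[OF bounded_linear_ident]]
        Ck_on_sum[OF \<open>open S\<close>] mult N fti)
  \<comment> \<open>Cramer's solution of \<open>M Y = b\<close> with
    \<open>b = - N ft\<close>.\<close>
  define Y where "Y z = (\<chi> l. det (\<chi> i j. if j = l then b z $ i else jacobian_y Q z $ i $ j) *
      inverse (det (jacobian_y Q z)))" for z
  have det: "det (jacobian_y Q z) \<noteq> 0" if "z \<in> S" for z
    using inv[OF that] by (simp add: invertible_det_nz)
  have "Ck_on k S Y"
  proof (rule Ck_on_vec[OF \<open>open S\<close>])
    fix l
    have "Ck_on k S (\<lambda>z. det (\<chi> i j. if j = l then b z $ i else jacobian_y Q z $ i $ j))"
    proof (rule Ck_on_det[OF \<open>open S\<close>])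
      show "Ck_on k S (\<lambda>z. (\<chi> i j. if j = l then b z $ i else jacobian_y Q z $ i $ j) $ i $ j)" for i j
        using b M by (cases "j = l") simp_all
    qed
    then show "Ck_on k S (\<lambda>z. Y z $ l)"
      unfolding Y_def vec_lambda_beta
      by (rule mult[OF _ Ck_on_inverse[OF \<open>open S\<close> det Ck_on_det[OF \<open>open S\<close> M]]])
  qed
  moreover have "(ft z, Y z) = extended_field Q ft z" if "z \<in> S" for z
  proof -
    have "jacobian_y Q z *v Y z = b z"
      unfolding cramer[OF det[OF that]] Y_def by (simp add: divide_inverse)
    then have "jacobian_action Q z (ft z, Y z) = 0"
      by (simp add: jacobian_action_def b_def vec_eq_iff matrix_vector_mult_def[of "jacobian_x Q z"])
    then show ?thesis
      using jacobian_action_eq_0_iff[OF inv[OF that]] by (simp add: extended_field_def)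
  qed
  ultimately show ?thesis
    using Ck_on_cong[OF \<open>open S\<close>, of "\<lambda>z. (ft z, Y z)"] Ck_on_Pair[OF \<open>open S\<close> ft] by blast
qed

section \<open>The reduced method on the constraint graph\<close>

locale constraint_graph =
  fixes Q :: "'d::finite \<Rightarrow> real^('n::finite + 'd)^('n + 'd)"
    and ft :: "(real^'n) \<times> (real^'d) \<Rightarrow> real^'n"
    and f :: "real^'n \<Rightarrow> real^'n"
    and \<phi> :: "real^'n \<Rightarrow> real^'d"
    and \<Omega> :: "((real^'n) \<times> (real^'d)) set"
    and D :: "(real^'n) set"
  assumes open_\<Omega>: "open \<Omega>" and open_D: "open D"
    and sym: "\<And>i. transpose (Q i) = Q i"
    and inv: "\<And>z. z \<in> \<Omega> \<Longrightarrow> invertible (jacobian_y Q z)"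
    and \<phi>: "Ck_on 1 D \<phi>"
    and graph: "{z \<in> \<Omega>. quadratic_forms Q z = 0} = {(x, \<phi> x) | x. x \<in> D}"
    and ft: "Ck_on 2 \<Omega> ft"
    and consistent: "\<And>x. x \<in> D \<Longrightarrow> ft (x, \<phi> x) = f x"
begin

abbreviation F where "F \<equiv> extended_field Q ft"

lemma F_C2: "Ck_on 2 \<Omega> F"
  using Ck_on_extended_field[OF open_\<Omega> sym inv ft] .

lemma F_C1: "Ck_on 1 \<Omega> F"
  using F_C2 Ck_on_SucD[of 1 \<Omega> F] by (simp add: numeral_2_eq_2 del: Ck_on.simps)

lemma ft_C1: "Ck_on 1 \<Omega> ft"
  using ft Ck_on_SucD[of 1 \<Omega> ft] by (simp add: numeral_2_eq_2 del: Ck_on.simps)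

lemma on_graph:
  assumes "x \<in> D"
  shows "(x, \<phi> x) \<in> \<Omega>" and "quadratic_forms Q (x, \<phi> x) = 0"
  using graph assms by auto

lemma on_graphD:
  assumes "z \<in> \<Omega>" and "quadratic_forms Q z = 0"
  shows "fst z \<in> D" and "snd z = \<phi> (fst z)"
proof -
  have "z \<in> {(x, \<phi> x) | x. x \<in> D}"
    using graph assms by blast
  then show "fst z \<in> D" and "snd z = \<phi> (fst z)"
    by auto
qed

text \<open>The stage may violate the constraint. This is harmless because \<open>F\<close> is
  tangent to the level set of \<open>G\<close> through every point of \<open>\<Omega>\<close>; hence
  all values of \<open>G\<close> are preserved, not only zero.\<close>

lemma implicit_midpoint_preserves_constraint:
  assumes "implicit_midpoint F \<Omega> h u v"
  shows "quadratic_forms Q v = quadratic_forms Q u"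
proof -
  define z where "z = midpoint u v"
  have "z \<in> \<Omega>" and v: "v - u = h *\<^sub>R F z"
    using assms by (auto simp: implicit_midpoint_def z_def algebra_simps)
  interpret J: bounded_bilinear "jacobian_action Q"
    by (rule bounded_bilinear_jacobian_action[OF sym])
  have "quadratic_forms Q v - quadratic_forms Q u = h *\<^sub>R jacobian_action Q z (F z)"
    unfolding quadratic_forms_diff[OF sym] v J.scaleR_right z_def[symmetric] ..
  then show ?thesis
    using jacobian_action_extended_field[OF inv[OF \<open>z \<in> \<Omega>\<close>]] by simp
qed

text \<open>Implicit differentiation: \<open>G (x, \<phi> x)\<close> vanishes on the open set
  \<open>D\<close>, so the vector \<open>(v, ?\<phi>' v)\<close> lies in the kernel of
  \<open>DG\<close>, which determines its second component.\<close>

lemma has_derivative_graph: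
  assumes "x \<in> D"
  shows "(\<phi> has_derivative (\<lambda>v. - ((pseudoinverse (jacobian_y Q (x, \<phi> x)) ** jacobian_x Q (x, \<phi> x)) *v v)))
    (at x)"
proof -
  let ?\<phi>' = "frechet_derivative \<phi> (at x)"
  have d: "(\<phi> has_derivative ?\<phi>') (at x)"
    using Ck_on_has_derivative[of 0 D \<phi>] \<phi> assms by simp
  have "((\<lambda>x. quadratic_forms Q (x, \<phi> x)) has_derivative (\<lambda>v. jacobian_action Q (x, \<phi> x) (v, ?\<phi>' v))) (at x)"
    using has_derivative_compose[OF has_derivative_Pair[OF has_derivative_ident d]
        has_derivative_quadratic_forms[OF sym]] .
  moreover have "((\<lambda>x. quadratic_forms Q (x, \<phi> x)) has_derivative (\<lambda>v. 0)) (at x)"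
    by (rule has_derivative_transform_within_open[OF has_derivative_const[of 0] open_D assms])
       (simp add: on_graph)
  ultimately have "(\<lambda>v. jacobian_action Q (x, \<phi> x) (v, ?\<phi>' v)) = (\<lambda>v. 0)"
    by (rule has_derivative_unique)
  then have "jacobian_action Q (x, \<phi> x) (v, ?\<phi>' v) = 0" for v
    by metis
  then have "?\<phi>' v = - ((pseudoinverse (jacobian_y Q (x, \<phi> x)) ** jacobian_x Q (x, \<phi> x)) *v v)" for v
    by (simp add: jacobian_action_eq_0_iff[OF inv[OF on_graph(1)[OF assms]]])
  then show ?thesis
    using d by (metis (no_types, lifting) ext)
qed

text \<open>The slope of \<open>\<phi>\<close> is the matrix in the second component of
  \<open>F\<close>, and on the graph \<open>ft\<close> equals \<open>f\<close>; the chain rule does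
  the rest.\<close>

lemma trajectory_graph:
  assumes w: "trajectory f D I w"
  shows "trajectory F \<Omega> I (\<lambda>t. (w t, \<phi> (w t)))"
proof -
  have "((\<lambda>t. (w t, \<phi> (w t))) has_vector_derivative F (w t, \<phi> (w t))) (at t within I)" if "t \<in> I" for t
  proof -
    have wD: "w t \<in> D" and w': "(w has_vector_derivative f (w t)) (at t within I)"
      using w that by (auto simp: trajectory_def)
    have "((\<lambda>t. \<phi> (w t)) has_vector_derivative - ((pseudoinverse (jacobian_y Q (w t, \<phi> (w t))) **
        jacobian_x Q (w t, \<phi> (w t))) *v f (w t))) (at t within I)"
      using vector_derivative_diff_chain_within[OF w' has_derivative_at_withinI[OF has_derivative_graph[OF wD]]]
      by (simp add: o_def)
    then show ?thesis
      using w' has_vector_derivative_Pair by (fastforce simp: extended_field_def consistent[OF wD])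
  qed
  then show ?thesis
    using w on_graph by (auto simp: trajectory_def)
qed

lemma midpoint_graph: "midpoint (x, \<phi> x) (y, \<phi> y) = (midpoint x y, midpoint (\<phi> x) (\<phi> y))"
  by (simp add: midpoint_def)

lemma reduced_midpoint_step:
  assumes "h \<noteq> 0"
  shows "reduced_midpoint ft \<phi> \<Omega> D h x y \<longleftrightarrow>
    (x \<in> D \<and> y \<in> D \<and> (midpoint x y, midpoint (\<phi> x) (\<phi> y)) \<in> \<Omega>) \<and>
    y = x + h *\<^sub>R ft (midpoint x y, midpoint (\<phi> x) (\<phi> y))"
proof -
  have "(y - x) /\<^sub>R h = v \<longleftrightarrow> y - x = h *\<^sub>R v" for v
    using assms by (metis divideR_right)
  then have "(y - x) /\<^sub>R h = v \<longleftrightarrow> y = x + h *\<^sub>R v" for v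
    by (simp add: algebra_simps)
  then show ?thesis
    by (simp add: reduced_midpoint_def)
qed

text \<open>
  Both end points satisfy the constraint, so the Jacobian at the midpoint annihilates the increment
  \<open>(y - x, \<phi> y - \<phi> x)\<close>; this recovers the second component of the extended step from the first.
\<close>

lemma reduced_midpoint_iff_implicit_midpoint:
  assumes "h \<noteq> 0"
  shows "reduced_midpoint ft \<phi> \<Omega> D h x y \<longleftrightarrow>
    x \<in> D \<and> y \<in> D \<and> implicit_midpoint F \<Omega> h (x, \<phi> x) (y, \<phi> y)"
proof (cases "x \<in> D \<and> y \<in> D \<and> (midpoint x y, midpoint (\<phi> x) (\<phi> y)) \<in> \<Omega>")
  case True
  define z where "z = (midpoint x y, midpoint (\<phi> x) (\<phi> y))"
  have "jacobian_action Q z (y - x, \<phi> y - \<phi> x) = 0"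
    using quadratic_forms_diff[where Q = Q, OF sym, where v = "(y, \<phi> y)" and u = "(x, \<phi> x)"] True
    by (simp add: on_graph midpoint_graph z_def)
  then have *: "\<phi> y - \<phi> x = - ((pseudoinverse (jacobian_y Q z) ** jacobian_x Q z) *v (y - x))"
    using True by (simp add: jacobian_action_eq_0_iff[OF inv] z_def)
  have "\<phi> y = \<phi> x + h *\<^sub>R snd (F z)" if "y = x + h *\<^sub>R ft z"
  proof -
    have "y - x = h *\<^sub>R ft z"
      using that by simp
    then have "\<phi> y - \<phi> x = h *\<^sub>R snd (F z)"
      using * by (simp add: extended_field_def linear_scale[OF matrix_vector_mul_linear])
    then show ?thesis
      by (simp add: algebra_simps)
  qed
  then show ?thesis
    using True
    by (auto simp: reduced_midpoint_step[OF assms] implicit_midpoint_def midpoint_graph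
        extended_field_def simp flip: z_def)
next
  case False
  then show ?thesis
    by (auto simp: reduced_midpoint_def implicit_midpoint_def midpoint_graph)
qed

lemma compact_graph:
  assumes "compact K" and "K \<subseteq> D"
  shows "compact ((\<lambda>x. (x, \<phi> x)) ` K)" and "(\<lambda>x. (x, \<phi> x)) ` K \<subseteq> \<Omega>"
proof -
  have "continuous_on K \<phi>"
    using \<phi> Ck_on_SucD[of 0 D \<phi>] continuous_on_subset[OF _ assms(2)] by simp
  then show "compact ((\<lambda>x. (x, \<phi> x)) ` K)"
    using assms(1) by (intro compact_continuous_image continuous_on_Pair continuous_on_id)
  show "(\<lambda>x. (x, \<phi> x)) ` K \<subseteq> \<Omega>"
    using on_graph assms(2) by auto
qed

text \<open>Unlike the defect, solvability and stability are proved directly in the \<open>x\<close>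
  variables. As the stage lies off the graph in general, \<open>ft\<close> is bounded on balls
  around graph points; the Lipschitz constant \<open>L1\<close> of \<open>\<phi>\<close> accounts
  for the factor \<open>1 + L1\<close>.\<close>

lemma reduced_increment_bounds:
  assumes "compact K" and "K \<subseteq> D"
  shows "\<exists>\<delta> B L. increment_bounds
    (\<lambda>x y. x \<in> D \<and> y \<in> D \<and> (midpoint x y, midpoint (\<phi> x) (\<phi> y)) \<in> \<Omega>)
    (\<lambda>x y. ft (midpoint x y, midpoint (\<phi> x) (\<phi> y))) K \<delta> B L"
proof -
  obtain \<delta>1 K1 where K1: "\<delta>1 > 0" "compact K1" "K1 \<subseteq> D" "\<And>c. c \<in> K \<Longrightarrow> cball c \<delta>1 \<subseteq> K1"
    using compact_nbhd[OF open_D assms] by blast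
  obtain L1 where L1: "L1 \<ge> 0" "\<And>A. convex A \<Longrightarrow> A \<subseteq> K1 \<Longrightarrow> L1-lipschitz_on A \<phi>"
    using Ck_on_lipschitz[OF \<phi> K1(2,3)] by blast
  obtain \<delta>2 K2 where K2: "\<delta>2 > 0" "compact K2" "K2 \<subseteq> \<Omega>"
      "\<And>c. c \<in> (\<lambda>x. (x, \<phi> x)) ` K \<Longrightarrow> cball c \<delta>2 \<subseteq> K2"
    using compact_nbhd[OF open_\<Omega> compact_graph[OF assms]] by blast
  obtain L2 where L2: "L2 \<ge> 0" "\<And>A. convex A \<Longrightarrow> A \<subseteq> K2 \<Longrightarrow> L2-lipschitz_on A ft"
    using Ck_on_lipschitz[OF ft_C1 K2(2,3)] by blast
  have "continuous_on K2 ft"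
    using ft_C1 Ck_on_SucD[of 0 \<Omega> ft] continuous_on_subset[OF _ K2(3)] by simp
  then obtain B where B: "B \<ge> 0" "\<And>z. z \<in> K2 \<Longrightarrow> norm (ft z) \<le> B"
    using continuous_on_compact_norm_bound K2(2) by blast
  \<comment> \<open>\<open>\<delta>1\<close> keeps the points in \<open>D\<close>. Moving
    \<open>x\<close> by \<open>\<delta>\<close> moves \<open>\<phi> x\<close> by at most
    \<open>L1 * \<delta>\<close>, so \<open>\<delta> + L1 * \<delta> \<le> \<delta>2\<close> keeps
    the stage in the ball around \<open>(c, \<phi> c)\<close>.\<close>
  define \<delta> where "\<delta> = min \<delta>1 (\<delta>2 / (1 + L1))"
  have "\<delta> \<le> \<delta>2 / (1 + L1)"
    by (simp add: \<delta>_def)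
  then have \<delta>: "0 < \<delta>" "\<delta> \<le> \<delta>1" "\<delta> + L1 * \<delta> \<le> \<delta>2"
    using K1(1) K2(1) L1(1) by (simp add: \<delta>_def, simp add: \<delta>_def, simp add: field_simps)
  define m where "m x y = (midpoint x y, midpoint (\<phi> x) (\<phi> y))" for x y
  have "increment_bounds (\<lambda>x y. x \<in> D \<and> y \<in> D \<and> m x y \<in> \<Omega>) (\<lambda>x y. ft (m x y)) K \<delta> B (L2 * (1 + L1))"
    unfolding increment_bounds_def
  proof (intro conjI ballI)
    fix c u v assume c: "c \<in> K" and uv: "u \<in> cball c \<delta>" "v \<in> cball c \<delta>"
    have sub: "cball c \<delta> \<subseteq> K1"
      using K1(4)[OF c] \<delta>(2) by auto
    then show "u \<in> D" "v \<in> D"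
      using uv K1(3) by auto
    have \<phi>_lip: "norm (\<phi> x - \<phi> y) \<le> L1 * norm (x - y)" if "x \<in> cball c \<delta>" "y \<in> cball c \<delta>" for x y
      using lipschitz_onD[OF L1(2)[OF convex_cball sub] that] by (simp add: dist_norm)
    have mem: "m x y \<in> cball (c, \<phi> c) \<delta>2" if "x \<in> cball c \<delta>" "y \<in> cball c \<delta>" for x y
    proof -
      have "\<phi> x \<in> cball (\<phi> c) (L1 * \<delta>)" if "x \<in> cball c \<delta>" for x
        using \<phi>_lip[of c x] that \<delta>(1) mult_left_mono[of "dist c x" \<delta> L1] L1(1) by (simp add: dist_norm)
      then have "midpoint x y \<in> cball c \<delta>" "midpoint (\<phi> x) (\<phi> y) \<in> cball (\<phi> c) (L1 * \<delta>)"
        using that by (auto intro!: midpoint_in_convex[OF convex_cball] simp del: mem_cball)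
      moreover have "dist (c, \<phi> c) (m x y) \<le> dist c (midpoint x y) + dist (\<phi> c) (midpoint (\<phi> x) (\<phi> y))"
        by (simp add: m_def dist_norm norm_Pair_le)
      ultimately show ?thesis
        using \<delta>(3) by simp
    qed
    have sub2: "cball (c, \<phi> c) \<delta>2 \<subseteq> K2"
      using K2(4) c by blast
    then have "m u v \<in> K2"
      using mem[OF uv] by blast
    then show "m u v \<in> \<Omega>" "norm (ft (m u v)) \<le> B"
      using K2(3) B(2) by blast+
    fix u' v' assume uv': "u' \<in> cball c \<delta>" "v' \<in> cball c \<delta>"
    have "norm (\<phi> u - \<phi> u') \<le> L1 * norm (u - u')" "norm (\<phi> v - \<phi> v') \<le> L1 * norm (v - v')"
      using \<phi>_lip uv uv' by auto
    then have "norm (midpoint (\<phi> u) (\<phi> v) - midpoint (\<phi> u') (\<phi> v')) \<le> L1 * (norm (u - u') + norm (v - v'))"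
      using norm_midpoint_diff_le[of "\<phi> u" "\<phi> v" "\<phi> u'" "\<phi> v'"] by (simp add: algebra_simps)
    moreover have "norm (m u v - m u' v') \<le> norm (midpoint u v - midpoint u' v') +
        norm (midpoint (\<phi> u) (\<phi> v) - midpoint (\<phi> u') (\<phi> v'))"
      by (simp add: m_def norm_Pair_le)
    ultimately have m: "norm (m u v - m u' v') \<le> (1 + L1) * (norm (u - u') + norm (v - v'))"
      using norm_midpoint_diff_le[of u v u' v'] by (simp add: algebra_simps)
    have "norm (ft (m u v) - ft (m u' v')) \<le> L2 * norm (m u v - m u' v')"
      using lipschitz_onD[OF L2(2)[OF convex_cball sub2] mem[OF uv] mem[OF uv']] by (simp add: dist_norm)
    also have "\<dots> \<le> L2 * ((1 + L1) * (norm (u - u') + norm (v - v')))"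
      using m L2(1) by (rule mult_left_mono)
    finally show "norm (ft (m u v) - ft (m u' v')) \<le> L2 * (1 + L1) * (norm (u - u') + norm (v - v'))"
      by (simp add: mult.assoc)
  qed (use \<delta>(1) B(1) L1(1) L2(1) in auto)
  then show ?thesis
    unfolding m_def by blast
qed

text \<open>The reduced defect is the first component of the extended defect along the lifted
  trajectory, and \<open>fst\<close> does not increase the norm.\<close>

lemma reduced_defect_bounds:
  assumes "compact K" and "K \<subseteq> D"
  shows "\<exists>h1 B C. defect_bounds f D (\<lambda>x y. ft (midpoint x y, midpoint (\<phi> x) (\<phi> y))) 2 K h1 B C"
proof -
  obtain h1 B C where d: "defect_bounds F \<Omega> (\<lambda>u v. F (midpoint u v)) 2 ((\<lambda>x. (x, \<phi> x)) ` K) h1 B C"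
    using midpoint_defect_bounds[OF open_\<Omega> F_C2 compact_graph[OF assms]] by blast
  have norm_fst: "norm (fst p) \<le> norm p" for p :: "(real^'n) \<times> (real^'d)"
    by (cases p) (simp add: norm_fst_le)
  have "norm (w h - w 0) \<le> B * h \<and>
      norm (w h - w 0 - h *\<^sub>R ft (midpoint (w 0) (w h), midpoint (\<phi> (w 0)) (\<phi> (w h)))) \<le> C * h ^ (2 + 1)"
    if w: "0 < h \<and> h \<le> h1 \<and> w 0 \<in> K \<and> trajectory f D {0..h} w" for h w
  proof -
    define z where "z t = (w t, \<phi> (w t))" for t
    have "0 < h \<and> h \<le> h1 \<and> z 0 \<in> (\<lambda>x. (x, \<phi> x)) ` K \<and> trajectory F \<Omega> {0..h} z"
      using w trajectory_graph unfolding z_def by blast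
    then have n: "norm (z h - z 0) \<le> B * h" "norm (z h - z 0 - h *\<^sub>R F (midpoint (z 0) (z h))) \<le> C * h ^ (2 + 1)"
      using d unfolding defect_bounds_def by blast+
    then show ?thesis
      using order_trans[OF norm_fst n(1)] order_trans[OF norm_fst n(2)]
      by (simp add: z_def midpoint_graph extended_field_def)
  qed
  then have "defect_bounds f D (\<lambda>x y. ft (midpoint x y, midpoint (\<phi> x) (\<phi> y))) 2 K h1 B C"
    using d unfolding defect_bounds_def by blast
  then show ?thesis
    by blast
qed

lemma reduced_midpoint_has_order: "has_order f D (reduced_midpoint ft \<phi> \<Omega> D) 2"
proof -
  have step: "reduced_midpoint ft \<phi> \<Omega> D h x y \<longleftrightarrow>
      (x \<in> D \<and> y \<in> D \<and> (midpoint x y, midpoint (\<phi> x) (\<phi> y)) \<in> \<Omega>) \<and>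
      y = x + h *\<^sub>R ft (midpoint x y, midpoint (\<phi> x) (\<phi> y))" if "0 < h" for h x y
    using reduced_midpoint_step that by simp
  show ?thesis
    unfolding has_order_def
    using local_error_orderI[OF step reduced_increment_bounds reduced_defect_bounds]
      global_error_orderI[OF step reduced_increment_bounds reduced_defect_bounds] by simp
qed

end

section \<open>Invariance along numerical solutions and the three claims\<close>

lemma numerical_solution_invariant:
  assumes "numerical_solution \<Phi> h K u" and "\<And>a b. \<Phi> h a b \<Longrightarrow> q b = q a" and "k \<le> K"
  shows "q (u k) = q (u 0)"
  using \<open>k \<le> K\<close>
proof (induction k)
  case (Suc k)
  then have "\<Phi> h (u k) (u (Suc k))"
    using assms(1) by (simp add: numerical_solution_def)
  then show ?case
    using Suc assms(2) by simp
qed simp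

theorem proposition2p5:
  fixes Q :: "'d::finite \<Rightarrow> real^('n::finite + 'd)^('n + 'd)"
    and G :: "(real^'n) \<times> (real^'d) \<Rightarrow> real^'d"
    and H :: "real^'n \<Rightarrow> real"
    and Ht :: "(real^'n) \<times> (real^'d) \<Rightarrow> real"
    and f :: "real^'n \<Rightarrow> real^'n"
    and ft :: "(real^'n) \<times> (real^'d) \<Rightarrow> real^'n"
    and F :: "(real^'n) \<times> (real^'d) \<Rightarrow> (real^'n) \<times> (real^'d)"
    and \<phi> :: "real^'n \<Rightarrow> real^'d"
    and \<Omega> :: "((real^'n) \<times> (real^'d)) set"
    and D :: "(real^'n) set"
  assumes "open \<Omega>" and "open D"
    and "gradient_invariant f D H"
    and "\<And>i. transpose (Q i) = Q i"
    and "G = quadratic_forms Q"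
    and "quadratic_dimension_raising \<Omega> G H Ht"
    and "smooth_on D \<phi>"
    and "{z \<in> \<Omega>. G z = 0} = {(x, \<phi> x) | x. x \<in> D}"
    and "Ck_on 2 \<Omega> ft"
    and "\<And>x. x \<in> D \<Longrightarrow> ft (x, \<phi> x) = f x"
    and "F = extended_field Q ft"
  shows
    "(has_order F \<Omega> (implicit_midpoint F \<Omega>) 2 \<and>
      (\<forall>q h K z. quadratic_invariant F \<Omega> q \<and> numerical_solution (implicit_midpoint F \<Omega>) h K z \<longrightarrow>
         (\<forall>k\<le>K. q (z k) = q (z 0)))) \<and>
     (\<forall>h K z. numerical_solution (implicit_midpoint F \<Omega>) h K z \<and> G (z 0) = 0 \<longrightarrow>
         (\<forall>k\<le>K. G (z k) = 0)) \<and>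
     ((\<forall>h K z. h \<noteq> 0 \<and> numerical_solution (implicit_midpoint F \<Omega>) h K z \<and>
         (\<forall>k\<le>K. z k \<in> \<Omega>) \<and> G (z 0) = 0 \<longrightarrow>
         (\<forall>k\<le>K. snd (z k) = \<phi> (fst (z k))) \<and>
         numerical_solution (reduced_midpoint ft \<phi> \<Omega> D) h K (\<lambda>k. fst (z k))) \<and>
      has_order f D (reduced_midpoint ft \<phi> \<Omega> D) 2 \<and>
      (quadratic_invariant F \<Omega> Ht \<longrightarrow>
        (\<forall>h K x. h \<noteq> 0 \<and> numerical_solution (reduced_midpoint ft \<phi> \<Omega> D) h K x \<longrightarrow>
           (\<forall>k<K. H (x (Suc k)) = H (x k)))))"
proof -
  have dr: "invertible (jacobian_y Q z)" if "z \<in> \<Omega>" for z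
    using assms(6) that jacobian_y_eq_partial_derivative[of Q "fst z" "snd z", OF assms(4)]
    unfolding quadratic_dimension_raising_def dimension_raising_def assms(5) by (cases z) fastforce
  have Ht: "Ht (x, y) = H x" if "(x, y) \<in> \<Omega>" "G (x, y) = 0" for x y
    using assms(6) that unfolding quadratic_dimension_raising_def dimension_raising_def by fastforce
  interpret constraint_graph Q ft f \<phi> \<Omega> D
    by standard (use assms dr in \<open>simp_all add: smooth_on_def\<close>)
  have F: "F = extended_field Q ft" and G: "G = quadratic_forms Q"
    by (fact assms)+
  have inv: "q v = q u" if "quadratic_invariant F \<Omega> q" "implicit_midpoint F \<Omega> h u v" for q h u v
    using quadratic_invariant_implicit_midpoint[OF open_\<Omega> F_C1] that unfolding F .
  have q: "q (z k) = q (z 0)"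
    if "quadratic_invariant F \<Omega> q" "numerical_solution (implicit_midpoint F \<Omega>) h K z" "k \<le> K" for q h K z k
    using numerical_solution_invariant[OF that(2) inv[OF that(1)] that(3)] .
  have constraint: "G (z k) = 0"
    if "numerical_solution (implicit_midpoint F \<Omega>) h K z" "G (z 0) = 0" "k \<le> K" for h K z k
    using numerical_solution_invariant[OF that(1) _ that(3), of "quadratic_forms Q"]
      implicit_midpoint_preserves_constraint that(2) unfolding F G by metis
  have reduced: "(\<forall>k\<le>K. snd (z k) = \<phi> (fst (z k))) \<and>
      numerical_solution (reduced_midpoint ft \<phi> \<Omega> D) h K (\<lambda>k. fst (z k))"
    if "h \<noteq> 0" "numerical_solution (implicit_midpoint F \<Omega>) h K z" "\<forall>k\<le>K. z k \<in> \<Omega>" "G (z 0) = 0" for h K z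
  proof -
    \<comment> \<open>An implicit midpoint step places only its stage in \<open>\<Omega>\<close>.
      The graph describes the zeros of \<open>G\<close> inside \<open>\<Omega>\<close>, so
      membership of the points \<open>z k\<close> themselves is a separate premise.\<close>
    have g: "fst (z k) \<in> D" "snd (z k) = \<phi> (fst (z k))" if "k \<le> K" for k
      using on_graphD[of "z k"] constraint[OF \<open>numerical_solution _ h K z\<close> \<open>G (z 0) = 0\<close> that]
        \<open>\<forall>k\<le>K. z k \<in> \<Omega>\<close> that unfolding G by auto
    then have z: "z k = (fst (z k), \<phi> (fst (z k)))" if "k \<le> K" for k
      using that by (simp add: prod_eq_iff)
    have "reduced_midpoint ft \<phi> \<Omega> D h (fst (z k)) (fst (z (Suc k)))" if "k < K" for k
    proof -
      have "implicit_midpoint F \<Omega> h (z k) (z (Suc k))"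
        using \<open>numerical_solution _ h K z\<close> that by (simp add: numerical_solution_def)
      then show ?thesis
        using z[of k] z[of "Suc k"] g[of k] g[of "Suc k"] that
        unfolding reduced_midpoint_iff_implicit_midpoint[OF \<open>h \<noteq> 0\<close>] F by simp
    qed
    then show ?thesis
      using g by (simp add: numerical_solution_def)
  qed
  \<comment> \<open>\<open>Ht\<close> equals \<open>H\<close> at both end points, which lie on the
    graph; the passage between them, through a stage off the graph, rests on the invariance of
    \<open>Ht\<close> under the extended step.\<close>
  have H: "H (x (Suc k)) = H (x k)"
    if "quadratic_invariant F \<Omega> Ht" "h \<noteq> 0" "numerical_solution (reduced_midpoint ft \<phi> \<Omega> D) h K x" "k < K"
    for h K x k
  proof -
    have s: "x k \<in> D" "x (Suc k) \<in> D" "implicit_midpoint F \<Omega> h (x k, \<phi> (x k)) (x (Suc k), \<phi> (x (Suc k)))"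
      using that(3,4) unfolding numerical_solution_def reduced_midpoint_iff_implicit_midpoint[OF \<open>h \<noteq> 0\<close>] F
      by auto
    then show ?thesis
      using inv[OF that(1) s(3)] by (simp add: Ht on_graph G)
  qed
  have "has_order F \<Omega> (implicit_midpoint F \<Omega>) 2"
    unfolding F by (rule implicit_midpoint_has_order[OF open_\<Omega> F_C2])
  then show ?thesis
    using q constraint reduced reduced_midpoint_has_order H by blast
qed

end
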